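(* Let $d\ge2$, let $\Psi_-:\mathbb{R}^d\to\mathbb{R}$ be Lipschitz, and let $u_0\in C(\mathbb{R}^d)$ satisfy $\Psi_-\le u_0$ on $\mathbb{R}^d$ and, for some $a<0$ and $R>0$, $u_0=a$ outside the ball $B(0,R)$. For $\epsilon>0$ define $u^\epsilon:\mathbb{R}^d\times\mathbb{R}\to\mathbb{R}$ by $u^\epsilon(x,t)=u_0(x)$ for $t\le0$ and, inductively, for $t>0$, $$u^\epsilon(x,t)=\max\Big\{\Psi_-(x),\ \sup_{(v^1,\dots,v^{d-1})}\ \min_{b\in\{\pm1\}^{d-1}}u^\epsilon\Big(x+\sqrt2\,\epsilon\sum_{j=1}^{d-1}b^jv^j,\ t-\epsilon^2\Big)\Big\},$$ where the supremum is over all $(d-1)$-tuples of mutually orthogonal unit vectors in $\mathbb{R}^d$. Define $$\overline u(x,t):=\varlimsup_{\substack{(y,s)\to(x,t)\\ \epsilon\searrow0}}u^\epsilon(y,s),\qquad \underline u(x,t):=\varliminf_{\substack{(y,s)\to(x,t)\\ \epsilon\searrow0}}u^\epsilon(y,s).$$ Then $\overline u$ and $\underline u$ are respectively a viscosity subsolution and a viscosity supersolution of $$\begin{cases}u_t+F(Du,D^2u)=0&\text{in }\mathbb{R}^d\times(0,\infty),\\ u(x,0)=u_0(x)&\text{in }\mathbb{R}^d,\\ \Psi_-(x)\le u(x,t)&\text{in }\mathbb{R}^d\times(0,\infty).\end{cases}$$ Moreover $\overline u(x,0)=\underline u(x,0)=u_0(x)$ for all $x\in\mathbb{R}^d$.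
   Context: $F(p,X)=-\mathrm{Tr}\big((I-\frac{p\otimes p}{|p|^2})X\big)$ for $p\in\mathbb{R}^d\setminus\{0\}$ and $X$ a real symmetric $d\times d$ matrix (level-set mean curvature flow operator). Upper and lower stars denote upper and lower semicontinuous envelopes. A function $u$ is a viscosity subsolution of the obstacle problem if (a) $\Psi_-(x)\le u^*(x,t)$ for all $(x,t)\in\mathbb{R}^d\times(0,\infty)$; (b) $u^*(x,0)\le u_0(x)$ for all $x$; (c) whenever $\phi$ is smooth, $u^*-\phi$ has a local maximum at $(x_0,t_0)\in\mathbb{R}^d\times(0,\infty)$ and $u^*(x_0,t_0)>\Psi_-(x_0)$, one has $\phi_t(x_0,t_0)+F_*(D\phi(x_0,t_0),D^2\phi(x_0,t_0))\le0$. It is a viscosity supersolution if (a) $\Psi_-(x)\le u_*(x,t)$ for all $(x,t)\in\mathbb{R}^d\times(0,\infty)$; (b) $u_*(x,0)\ge u_0(x)$ for all $x$; (c) whenever $\phi$ is smooth and $u_*-\phi$ has a local minimum at $(x_0,t_0)\in\mathbb{R}^d\times(0,\infty)$, one has $\phi_t(x_0,t_0)+F^*(D\phi(x_0,t_0),D^2\phi(x_0,t_0))\ge0$. The function $u^\epsilon$ is the value function of a two-person game in which the first player, at each round, may stop and receive $\Psi_-$ at the current position, or choose the vectors $v^j$, after which the second player chooses the signs $b^j$; after about $t\epsilon^{-2}$ rounds the first player receives $u_0$ at the final position. *)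

theory Defs
  imports "HOL-Analysis.Analysis"
begin

section \<open>Semicontinuous envelopes\<close>

text \<open>
  Envelopes of a function on the domain \<open>D\<close>, at points of the closure of \<open>D\<close>.  The filter
  \<open>inf (nhds z) (principal D)\<close> does not remove the point \<open>z\<close> itself.
  Values are extended reals, so that the limits are meaningful without a boundedness assumption.
\<close>

definition usc_envelope :: "'a::topological_space set \<Rightarrow> ('a \<Rightarrow> ereal) \<Rightarrow> 'a \<Rightarrow> ereal" where
  "usc_envelope D f z = Limsup (inf (nhds z) (principal D)) f"

definition lsc_envelope :: "'a::topological_space set \<Rightarrow> ('a \<Rightarrow> ereal) \<Rightarrow> 'a \<Rightarrow> ereal" where
  "lsc_envelope D f z = Liminf (inf (nhds z) (principal D)) f"


section \<open>The level-set mean curvature flow operator\<close>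

definition outer_product :: "real^'n \<Rightarrow> real^'n \<Rightarrow> real^'n^'n" where
  "outer_product p q = (\<chi> i j. p $ i * q $ j)"

definition mcf_operator :: "real^'n \<Rightarrow> real^'n^'n \<Rightarrow> real" where
  "mcf_operator p X = - trace ((mat 1 - (1 / (norm p)\<^sup>2) *\<^sub>R outer_product p p) ** X)"

definition mcf_domain :: "((real^'n) \<times> (real^'n^'n)) set" where
  "mcf_domain = {(p, X). p \<noteq> 0 \<and> transpose X = X}"

definition mcf_operator_usc :: "real^'n \<Rightarrow> real^'n^'n \<Rightarrow> ereal" where
  "mcf_operator_usc p X = usc_envelope mcf_domain (\<lambda>(q, Y). ereal (mcf_operator q Y)) (p, X)"

definition mcf_operator_lsc :: "real^'n \<Rightarrow> real^'n^'n \<Rightarrow> ereal" where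
  "mcf_operator_lsc p X = lsc_envelope mcf_domain (\<lambda>(q, Y). ereal (mcf_operator q Y)) (p, X)"


section \<open>Smooth test functions and their derivatives\<close>

text \<open>Being \<open>k\<close> times continuously differentiable, for an open set \<open>S\<close>.\<close>

primrec k_times_cont_diff_on :: "nat \<Rightarrow> 'a::euclidean_space set \<Rightarrow> ('a \<Rightarrow> real) \<Rightarrow> bool" where
  "k_times_cont_diff_on 0 S f \<longleftrightarrow> continuous_on S f"
| "k_times_cont_diff_on (Suc k) S f \<longleftrightarrow>
     (\<forall>x\<in>S. f differentiable (at x)) \<and>
     (\<forall>v. k_times_cont_diff_on k S (\<lambda>x. frechet_derivative f (at x) v))"

definition smooth_on :: "'a::euclidean_space set \<Rightarrow> ('a \<Rightarrow> real) \<Rightarrow> bool" where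
  "smooth_on S f \<longleftrightarrow> (\<forall>k. k_times_cont_diff_on k S f)"

definition gradient :: "(real^'n \<Rightarrow> real) \<Rightarrow> real^'n \<Rightarrow> real^'n" where
  "gradient f x = (\<chi> i. frechet_derivative f (at x) (axis i 1))"

definition hessian :: "(real^'n \<Rightarrow> real) \<Rightarrow> real^'n \<Rightarrow> real^'n^'n" where
  "hessian f x = (\<chi> i j. frechet_derivative (\<lambda>y. gradient f y $ j) (at x) (axis i 1))"


section \<open>Viscosity sub- and supersolutions of the obstacle problem\<close>

text \<open>
  The unknown \<open>u\<close> lives on \<open>\<real>\<^sup>d \<times> [0,\<infinity>)\<close>; its envelopes are taken relative to that set.
\<close>

abbreviation space_time :: "((real^'n) \<times> real) set" where
  "space_time \<equiv> UNIV \<times> {0..}"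

definition viscosity_subsolution ::
  "(real^'n \<Rightarrow> real) \<Rightarrow> (real^'n \<Rightarrow> real) \<Rightarrow> ((real^'n) \<times> real \<Rightarrow> ereal) \<Rightarrow> bool" where
  "viscosity_subsolution \<Psi> u0 u \<longleftrightarrow>
     (let us = usc_envelope space_time u in
       (\<forall>x t. t > 0 \<longrightarrow> ereal (\<Psi> x) \<le> us (x, t)) \<and>
       (\<forall>x. us (x, 0) \<le> ereal (u0 x)) \<and>
       (\<forall>\<phi> x0 t0.
          smooth_on (UNIV \<times> {0<..}) \<phi> \<and> t0 > 0 \<and>
          (\<forall>\<^sub>F z in nhds (x0, t0). us z - ereal (\<phi> z) \<le> us (x0, t0) - ereal (\<phi> (x0, t0))) \<and>
          us (x0, t0) > ereal (\<Psi> x0) \<longrightarrow>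
          ereal (deriv (\<lambda>t. \<phi> (x0, t)) t0) +
            mcf_operator_lsc (gradient (\<lambda>x. \<phi> (x, t0)) x0) (hessian (\<lambda>x. \<phi> (x, t0)) x0) \<le> 0))"

definition viscosity_supersolution ::
  "(real^'n \<Rightarrow> real) \<Rightarrow> (real^'n \<Rightarrow> real) \<Rightarrow> ((real^'n) \<times> real \<Rightarrow> ereal) \<Rightarrow> bool" where
  "viscosity_supersolution \<Psi> u0 u \<longleftrightarrow>
     (let us = lsc_envelope space_time u in
       (\<forall>x t. t > 0 \<longrightarrow> ereal (\<Psi> x) \<le> us (x, t)) \<and>
       (\<forall>x. us (x, 0) \<ge> ereal (u0 x)) \<and>
       (\<forall>\<phi> x0 t0.
          smooth_on (UNIV \<times> {0<..}) \<phi> \<and> t0 > 0 \<and>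
          (\<forall>\<^sub>F z in nhds (x0, t0). us z - ereal (\<phi> z) \<ge> us (x0, t0) - ereal (\<phi> (x0, t0))) \<longrightarrow>
          ereal (deriv (\<lambda>t. \<phi> (x0, t)) t0) +
            mcf_operator_usc (gradient (\<lambda>x. \<phi> (x, t0)) x0) (hessian (\<lambda>x. \<phi> (x, t0)) x0) \<ge> 0))"


section \<open>The value function of the game and its half-relaxed limits\<close>

text \<open>
  Tuples \<open>(v\<^sup>1,\<dots>,v\<^sup>d\<^sup>-\<^sup>1)\<close> are functions on \<open>{1..<d}\<close>, extended by \<open>undefined\<close>.
\<close>

definition orthonormal_tuples :: "(nat \<Rightarrow> real^'n) set" where
  "orthonormal_tuples =
     {v \<in> extensional {1..<CARD('n)}.
        (\<forall>j\<in>{1..<CARD('n)}. norm (v j) = 1) \<and>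
        pairwise (\<lambda>i j. orthogonal (v i) (v j)) {1..<CARD('n)}}"

text \<open>
  The supremum is one of reals.  If \<open>\<Psi> \<le> u0\<close> and \<open>m \<le> u0 \<le> M\<close>, then by induction on the number
  of rounds \<open>m \<le> game_value \<Psi> u0 \<epsilon> \<le> M\<close>, so it is then a supremum of a nonempty bounded set.
  For \<open>\<epsilon> \<le> 0\<close> the value is irrelevant.
\<close>

function game_value ::
  "(real^'n \<Rightarrow> real) \<Rightarrow> (real^'n \<Rightarrow> real) \<Rightarrow> real \<Rightarrow> real^'n \<Rightarrow> real \<Rightarrow> real" where
  "game_value \<Psi> u0 \<epsilon> x t =
     (if t \<le> 0 \<or> \<epsilon> \<le> 0 then u0 x
      else max (\<Psi> x)
        (SUP v\<in>orthonormal_tuples. MIN b\<in>{1..<CARD('n)} \<rightarrow>\<^sub>E {-1, 1}.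
           game_value \<Psi> u0 \<epsilon>
             (x + (sqrt 2 * \<epsilon>) *\<^sub>R (\<Sum>j\<in>{1..<CARD('n)}. b j *\<^sub>R v j)) (t - \<epsilon>\<^sup>2)))"
  by pat_completeness auto
termination
proof (relation "Wellfounded.measure (\<lambda>(\<Psi>, u0, \<epsilon>, x, t). nat \<lceil>t / \<epsilon>\<^sup>2\<rceil>)")
  fix t \<epsilon> :: real
  assume "\<not> (t \<le> 0 \<or> \<epsilon> \<le> 0)"
  then have "t / \<epsilon>\<^sup>2 > 0" and "(t - \<epsilon>\<^sup>2) / \<epsilon>\<^sup>2 = t / \<epsilon>\<^sup>2 - 1"
    by (auto simp: diff_divide_distrib)
  then have "nat \<lceil>(t - \<epsilon>\<^sup>2) / \<epsilon>\<^sup>2\<rceil> < nat \<lceil>t / \<epsilon>\<^sup>2\<rceil>"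
    by simp
  then show "((\<Psi>, u0, \<epsilon>, y, t - \<epsilon>\<^sup>2), (\<Psi>, u0, \<epsilon>, x, t))
      \<in> Wellfounded.measure (\<lambda>(\<Psi>, u0, \<epsilon>, x, t). nat \<lceil>t / \<epsilon>\<^sup>2\<rceil>)"
    for \<Psi> u0 :: "real^'n \<Rightarrow> real" and x y :: "real^'n"
    by simp
qed simp

declare game_value.simps [simp del]

definition upper_relaxed_limit ::
  "(real \<Rightarrow> real^'n \<Rightarrow> real \<Rightarrow> real) \<Rightarrow> (real^'n) \<times> real \<Rightarrow> ereal" where
  "upper_relaxed_limit w z =
     Limsup (nhds z \<times>\<^sub>F at_right 0) (\<lambda>((y, s), \<epsilon>). ereal (w \<epsilon> y s))"

definition lower_relaxed_limit ::
  "(real \<Rightarrow> real^'n \<Rightarrow> real \<Rightarrow> real) \<Rightarrow> (real^'n) \<times> real \<Rightarrow> ereal" where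
  "lower_relaxed_limit w z =
     Liminf (nhds z \<times>\<^sub>F at_right 0) (\<lambda>((y, s), \<epsilon>). ereal (w \<epsilon> y s))"

end

theory Submission
  imports Defs
begin

text \<open>
The proof follows the half-relaxed limit method: at a point where a smooth test function touches
one of the limits, the dynamic programming principle of the game turns into a differential
inequality for the test function.  Write \<open>S = \<Sum>\<^sub>j b\<^sub>j v\<^sub>j\<close> for the displacement of one round, \<open>p\<close> and
\<open>X\<close> for the spatial gradient and Hessian of the test function \<open>\<phi>\<close>.

A second-order expansion shows that one round changes \<open>\<phi>\<close> by
\<open>\<surd>2 \<epsilon> p\<bullet>S + \<epsilon>\<^sup>2 (S\<bullet>X S - \<phi>\<^sub>t)\<close> up to \<open>o(\<epsilon>\<^sup>2)\<close>.  If the first player's tuple is orthogonal to \<open>p\<close>, the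
first-order term vanishes for every choice of signs, and if the tuple also diagonalizes \<open>X\<close> on the
hyperplane, then \<open>S\<bullet>X S = \<Sum>\<^sub>j v\<^sub>j\<bullet>X v\<^sub>j\<close> whatever the signs are.  This sum is \<open>- F(p, X)\<close>
when \<open>p \<noteq> 0\<close>, and in general it lies between the negatives of the two envelopes of \<open>F\<close>
(\<open>mcf_envelope_bounds\<close>).

For the lower limit the first player is free to use such a tuple, which exists by the spectral
theorem (\<open>orthonormal_tuple_diagonalizing\<close>); this gives \<open>supersolution_optimality\<close>.
For the upper limit, away from the obstacle, a nearly optimal tuple is given, and every choice of
signs must almost preserve the value.  Comparing the signs \<open>b\<close> and \<open>-b\<close> forces the limiting tuple to
be orthogonal to \<open>p\<close> and yields \<open>S\<bullet>X S \<ge> \<phi>\<^sub>t\<close> for all signs; some choice of signs has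
\<open>S\<bullet>X S \<le> \<Sum>\<^sub>j v\<^sub>j\<bullet>X v\<^sub>j\<close> (\<open>signs_reduce_quadratic_form\<close>), so the sum dominates \<open>\<phi>\<^sub>t\<close>.  This is
\<open>subsolution_optimality\<close>.

Both arguments need points where \<open>u\<^sup>\<epsilon> - \<phi>\<close> is almost extremal up to \<open>\<epsilon>\<^sup>3\<close>, which is negligible against
the \<open>\<epsilon>\<^sup>2\<close> of the expansion.  They come from \<open>penalized_maximizers\<close>, after a quartic term has made
the extremum strict without changing the derivatives up to second order at the touching point.

The initial values rest on explicit barriers \<open>A \<plusminus> (C |y - x|\<^sup>2 + K t)\<close>
(\<open>game_value_upper_barrier\<close>, \<open>game_value_lower_barrier\<close>): each round adds exactly
\<open>2 \<epsilon>\<^sup>2 (d - 1)\<close> to \<open>|y - x|\<^sup>2\<close>, apart from a cross term that either player can turn to the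
useful sign or to zero.
\<close>

section \<open>Orthonormal tuples and quadratic forms\<close>

text \<open>
The mean of the left-hand side over all signs is the right-hand side, since the cross terms cancel.
Choosing the signs one after the other, each so that its cross term with the partial sum is not
positive, produces a suitable choice.
\<close>

lemma signs_reduce_quadratic_form:
  fixes B :: "'a::real_vector \<Rightarrow> 'a \<Rightarrow> real"
  assumes "finite J" and B: "bilinear B" and sym: "\<And>x y. B x y = B y x"
  shows "\<exists>b\<in>J \<rightarrow>\<^sub>E {-1, 1::real}.
           B (\<Sum>j\<in>J. b j *\<^sub>R v j) (\<Sum>j\<in>J. b j *\<^sub>R v j) \<le> (\<Sum>j\<in>J. B (v j) (v j))"
  using \<open>finite J\<close>
proof (induction J)
  case empty
  then show ?case using bilinear_lzero[OF B] by auto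
next
  case (insert i J)
  then obtain b where b: "b \<in> J \<rightarrow>\<^sub>E {-1, 1::real}"
    "B (\<Sum>j\<in>J. b j *\<^sub>R v j) (\<Sum>j\<in>J. b j *\<^sub>R v j) \<le> (\<Sum>j\<in>J. B (v j) (v j))" by blast
  define s where "s = (\<Sum>j\<in>J. b j *\<^sub>R v j)"
  define c :: real where "c = (if B s (v i) \<le> 0 then 1 else -1)"
  have c: "c = 1 \<or> c = -1" "c * B s (v i) \<le> 0" "c * c = 1" by (auto simp: c_def)
  have "(\<Sum>j\<in>J. (b(i := c)) j *\<^sub>R v j) = s"
    unfolding s_def using insert.hyps by (intro sum.cong) auto
  then have sum: "(\<Sum>j\<in>insert i J. (b(i := c)) j *\<^sub>R v j) = c *\<^sub>R v i + s"
    using insert.hyps by simp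
  have "B (c *\<^sub>R v i + s) (c *\<^sub>R v i + s) = (c * c) * B (v i) (v i) + 2 * (c * B s (v i)) + B s s"
    using sym[of "v i" s]
    by (simp add: bilinear_ladd[OF B] bilinear_radd[OF B] bilinear_lmul[OF B] bilinear_rmul[OF B]
        algebra_simps)
  also have "\<dots> \<le> B (v i) (v i) + (\<Sum>j\<in>J. B (v j) (v j))"
    using c b(2) unfolding s_def[symmetric] by simp
  also have "\<dots> = (\<Sum>j\<in>insert i J. B (v j) (v j))" using insert.hyps by simp
  finally have "B (\<Sum>j\<in>insert i J. (b(i := c)) j *\<^sub>R v j) (\<Sum>j\<in>insert i J. (b(i := c)) j *\<^sub>R v j)
      \<le> (\<Sum>j\<in>insert i J. B (v j) (v j))" unfolding sum .
  moreover have "b(i := c) \<in> insert i J \<rightarrow>\<^sub>E {-1, 1}"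
    using b(1) c(1) by (auto simp: PiE_iff extensional_def)
  ultimately show ?case by blast
qed

lemma quadratic_form_of_diagonal_signs:
  fixes B :: "'a::real_vector \<Rightarrow> 'a \<Rightarrow> real"
  assumes "finite J" and B: "bilinear B"
    and diag: "\<And>i j. i \<in> J \<Longrightarrow> j \<in> J \<Longrightarrow> i \<noteq> j \<Longrightarrow> B (v i) (v j) = 0"
    and b: "\<And>j. j \<in> J \<Longrightarrow> b j \<in> {-1, 1::real}"
  shows "B (\<Sum>j\<in>J. b j *\<^sub>R v j) (\<Sum>j\<in>J. b j *\<^sub>R v j) = (\<Sum>j\<in>J. B (v j) (v j))"
proof -
  have "B (\<Sum>j\<in>J. b j *\<^sub>R v j) (\<Sum>j\<in>J. b j *\<^sub>R v j)
      = (\<Sum>i\<in>J. \<Sum>j\<in>J. b i * (b j * B (v i) (v j)))"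
    by (simp add: bilinear_sum[OF B] sum.cartesian_product
        bilinear_lmul[OF B] bilinear_rmul[OF B] split_def mult.left_commute)
  also have "\<dots> = (\<Sum>i\<in>J. B (v i) (v i))"
  proof (rule sum.cong[OF refl])
    fix i assume i: "i \<in> J"
    have "(\<Sum>j\<in>J. b i * (b j * B (v i) (v j))) = (\<Sum>j\<in>J. if j = i then B (v i) (v i) else 0)"
      using diag[OF i] b[OF i] by (intro sum.cong) (auto simp: mult.assoc[symmetric])
    then show "(\<Sum>j\<in>J. b i * (b j * B (v i) (v j))) = B (v i) (v i)"
      using i \<open>finite J\<close> by simp
  qed
  finally show ?thesis .
qed

text \<open>
Lower bounds on dimension survive the step of the diagonalization below: a unit vector is split off
and at most one dimension is lost.
\<close>

lemma dim_orthogonal_slice: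
  fixes S :: "'a::euclidean_space set"
  assumes "subspace S" "v \<in> S" "norm v = 1"
  shows "dim S \<le> Suc (dim {w \<in> S. orthogonal v w})"
proof -
  have "S \<subseteq> span (insert v {w \<in> S. orthogonal v w})"
  proof
    fix x assume x: "x \<in> S"
    define w where "w = x - (x \<bullet> v) *\<^sub>R v"
    have "v \<bullet> v = 1" using assms(3) by (simp add: norm_eq_1)
    then have "w \<in> {w \<in> S. orthogonal v w}"
      unfolding w_def using assms x
      by (auto simp: orthogonal_def inner_diff_right inner_commute intro!: subspace_diff subspace_scale)
    then have "w \<in> span (insert v {w \<in> S. orthogonal v w})"
      by (simp add: span_base)
    moreover have "(x \<bullet> v) *\<^sub>R v \<in> span (insert v {w \<in> S. orthogonal v w})"
      by (simp add: span_base span_scale)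
    ultimately have "w + (x \<bullet> v) *\<^sub>R v \<in> span (insert v {w \<in> S. orthogonal v w})"
      by (rule span_add)
    then show "x \<in> span (insert v {w \<in> S. orthogonal v w})" by (simp add: w_def)
  qed
  then have "dim S \<le> dim (insert v {w \<in> S. orthogonal v w})"
    using dim_subset[of S "span (insert v {w \<in> S. orthogonal v w})"] by simp
  also have "\<dots> \<le> Suc (dim {w \<in> S. orthogonal v w})" by (simp add: dim_insert)
  finally show ?thesis .
qed

text \<open>
The first variation at a maximizer of the Rayleigh quotient: moving from \<open>v\<close> by \<open>\<tau> w\<close> gains
\<open>2 \<tau> B v w\<close> at first order but costs only \<open>O(\<tau>\<^sup>2)\<close> in normalization, for both signs of \<open>\<tau>\<close>.
\<close>

lemma maximizer_of_form_is_critical: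
  fixes B :: "'a::euclidean_space \<Rightarrow> 'a \<Rightarrow> real"
  assumes B: "bilinear B" and sym: "\<And>x y. B x y = B y x" and S: "subspace S"
    and v: "v \<in> S" "norm v = 1" and max: "\<And>w. w \<in> S \<Longrightarrow> norm w = 1 \<Longrightarrow> B w w \<le> B v v"
    and w: "w \<in> S" "orthogonal v w"
  shows "B v w = 0"
proof -
  have max': "B x x \<le> (norm x)\<^sup>2 * B v v" if "x \<in> S" for x
  proof (cases "x = 0")
    case True
    then show ?thesis using bilinear_lzero[OF B] by simp
  next
    case False
    then have "B ((1 / norm x) *\<^sub>R x) ((1 / norm x) *\<^sub>R x) \<le> B v v"
      using that S by (intro max) (auto intro: subspace_scale)
    then show ?thesis using False
      by (simp add: bilinear_lmul[OF B] bilinear_rmul[OF B] field_simps power2_eq_square)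
  qed
  define k where "k = (norm w)\<^sup>2 * B v v - B w w"
  have ineq: "2 * \<tau> * B v w \<le> \<tau>\<^sup>2 * k" for \<tau>
  proof -
    have "v + \<tau> *\<^sub>R w \<in> S" using v w S by (auto intro: subspace_add subspace_scale)
    from max'[OF this] have "B (v + \<tau> *\<^sub>R w) (v + \<tau> *\<^sub>R w) \<le> (1 + \<tau>\<^sup>2 * (norm w)\<^sup>2) * B v v"
      using w v by (simp add: norm_add_Pythagorean orthogonal_clauses power_mult_distrib)
    then show ?thesis using sym[of w v]
      by (simp add: bilinear_ladd[OF B] bilinear_radd[OF B] bilinear_lmul[OF B] bilinear_rmul[OF B]
          k_def algebra_simps power2_eq_square)
  qed
  have "((\<lambda>\<tau>. \<tau> * k) \<longlongrightarrow> 0) (at_right 0)" "((\<lambda>\<tau>. \<tau> * k) \<longlongrightarrow> 0) (at_left 0)"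
    by (auto intro!: tendsto_eq_intros)
  moreover have "\<forall>\<^sub>F \<tau> in at_right 0. 2 * B v w \<le> \<tau> * k"
    using eventually_at_right_less[of "0::real"]
  proof eventually_elim
    case (elim \<tau>)
    have "\<tau> * (2 * B v w) \<le> \<tau> * (\<tau> * k)" using ineq[of \<tau>] by (simp add: power2_eq_square algebra_simps)
    then show ?case using elim by (simp only: mult_le_cancel_left_pos)
  qed
  moreover have "\<forall>\<^sub>F \<tau> in at_left 0. \<tau> * k \<le> 2 * B v w"
    using eventually_at_left_real[of "-1" "0::real", simplified]
  proof eventually_elim
    case (elim \<tau>)
    have "\<tau> * (2 * B v w) \<le> \<tau> * (\<tau> * k)" using ineq[of \<tau>] by (simp add: power2_eq_square algebra_simps)
    then show ?case using elim by (auto simp only: mult_le_cancel_left_neg greaterThanLessThan_iff)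
  qed
  ultimately have "2 * B v w \<le> 0" "0 \<le> 2 * B v w"
    using tendsto_lowerbound[of "\<lambda>\<tau>. \<tau> * k" 0 "at_right 0" "2 * B v w"]
      tendsto_upperbound[of "\<lambda>\<tau>. \<tau> * k" 0 "at_left 0" "2 * B v w"] by simp_all
  then show ?thesis by simp
qed

text \<open>
The spectral theorem on a subspace, by splitting off one maximizer of the form at a time.  The
vectors are indexed from 1, to match the tuples of the game.
\<close>

lemma orthonormal_diagonalization:
  fixes B :: "'a::euclidean_space \<Rightarrow> 'a \<Rightarrow> real"
  assumes B: "bilinear B" and sym: "\<And>x y. B x y = B y x" and "subspace S" and "k \<le> dim S"
  shows "\<exists>v::nat \<Rightarrow> 'a. (\<forall>i\<in>{1..k}. v i \<in> S \<and> norm (v i) = 1) \<and>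
           (\<forall>i\<in>{1..k}. \<forall>j\<in>{1..k}. i \<noteq> j \<longrightarrow> orthogonal (v i) (v j) \<and> B (v i) (v j) = 0)"
  using assms(3,4)
proof (induction k arbitrary: S)
  case 0
  then show ?case by auto
next
  case (Suc k)
  have "\<not> S \<subseteq> {0}" using Suc.prems(2) dim_eq_0[of S] by linarith
  then obtain e where e: "e \<in> S" "e \<noteq> 0" by auto
  have ne: "(1 / norm e) *\<^sub>R e \<in> S \<inter> sphere 0 1"
    using e Suc.prems(1) by (auto intro: subspace_scale)
  have cpt: "compact (S \<inter> sphere 0 1)"
    using closed_subspace[OF Suc.prems(1)] by (intro closed_Int_compact) auto
  have cont: "continuous_on (S \<inter> sphere 0 1) (\<lambda>x. B x x)"
    using B unfolding bilinear_conv_bounded_bilinear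
    by (rule bounded_bilinear.continuous_on) (auto intro: continuous_intros)
  from ne have "S \<inter> sphere 0 1 \<noteq> {}" by blast
  from continuous_attains_sup[OF cpt this cont] obtain u
    where u: "u \<in> S" "norm u = 1" "\<And>w. w \<in> S \<Longrightarrow> norm w = 1 \<Longrightarrow> B w w \<le> B u u"
    by auto
  define S' where "S' = {w \<in> S. orthogonal u w}"
  have S': "subspace S'"
    using Suc.prems(1) unfolding S'_def subspace_def by (auto simp: orthogonal_clauses)
  have "k \<le> dim S'" using dim_orthogonal_slice[OF Suc.prems(1) u(1,2)] Suc.prems(2)
    unfolding S'_def by simp
  from Suc.IH[OF S' this] obtain v where v:
    "\<And>i. i \<in> {1..k} \<Longrightarrow> v i \<in> S' \<and> norm (v i) = 1"
    "\<And>i j. i \<in> {1..k} \<Longrightarrow> j \<in> {1..k} \<Longrightarrow> i \<noteq> j \<Longrightarrow> orthogonal (v i) (v j) \<and> B (v i) (v j) = 0"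
    by metis
  have crit: "B u w = 0" "B w u = 0" "orthogonal u w" "orthogonal w u" "w \<in> S" if "w \<in> S'" for w
    using maximizer_of_form_is_critical[OF B sym Suc.prems(1) u, of w] that sym[of w u]
    by (auto simp: S'_def orthogonal_commute)
  let ?v = "v(Suc k := u)"
  have split: "i \<in> {1..Suc k} \<longleftrightarrow> i = Suc k \<or> i \<in> {1..k}" for i by auto
  have upd: "?v i = v i" if "i \<in> {1..k}" for i using that by auto
  show ?case
  proof (intro exI[of _ ?v] conjI ballI impI)
    fix i assume i: "i \<in> {1..Suc k}"
    then show "?v i \<in> S" "norm (?v i) = 1" using u v(1)[of i] crit(5)[of "v i"] by (auto simp: split)
    fix j assume "j \<in> {1..Suc k}" "i \<noteq> j"
    then show "orthogonal (?v i) (?v j)" "B (?v i) (?v j) = 0"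
      using i v(1)[of i] v(1)[of j] v(2)[of i j] crit[of "v i"] crit[of "v j"]
      by (auto simp: split)
  qed
qed

lemma orthonormal_tuple_diagonalizing:
  fixes B :: "real^'n \<Rightarrow> real^'n \<Rightarrow> real" and p :: "real^'n"
  assumes B: "bilinear B" and sym: "\<And>x y. B x y = B y x"
  shows "\<exists>v\<in>orthonormal_tuples. (\<forall>j\<in>{1..<CARD('n)}. v j \<bullet> p = 0) \<and>
           (\<forall>i\<in>{1..<CARD('n)}. \<forall>j\<in>{1..<CARD('n)}. i \<noteq> j \<longrightarrow> B (v i) (v j) = 0)"
proof -
  have S: "subspace {x. p \<bullet> x = 0}" by (rule subspace_hyperplane)
  have "CARD('n) - 1 \<le> dim {x. p \<bullet> x = 0}"
    by (cases "p = 0") (auto simp: dim_hyperplane)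
  from orthonormal_diagonalization[OF B sym S this] obtain v :: "nat \<Rightarrow> real^'n" where v:
    "\<forall>i\<in>{1..CARD('n) - 1}. v i \<in> {x. p \<bullet> x = 0} \<and> norm (v i) = 1"
    "\<forall>i\<in>{1..CARD('n) - 1}. \<forall>j\<in>{1..CARD('n) - 1}. i \<noteq> j \<longrightarrow> orthogonal (v i) (v j) \<and> B (v i) (v j) = 0"
    by blast
  have "{1..CARD('n) - 1} = {1..<CARD('n)}" using zero_less_card_finite[where 'a='n] by auto
  note v = v[unfolded this]
  have "restrict v {1..<CARD('n)} \<in> orthonormal_tuples"
    using v unfolding orthonormal_tuples_def by (auto simp: pairwise_def)
  then show ?thesis using v by (intro bexI) (auto simp: inner_commute)
qed

section \<open>The envelopes of the mean curvature operator\<close>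

text \<open>
A tuple has one vector fewer than the dimension, so a unit normal exists and completes the tuple to
an orthonormal basis.  Completeness is stated as the expansion formula because this is the form in which
the trace is computed.
\<close>

lemma orthonormal_tuple_normal:
  fixes v :: "nat \<Rightarrow> real^'n"
  assumes "v \<in> orthonormal_tuples"
  obtains n where "norm n = 1" "\<And>j. j \<in> {1..<CARD('n)} \<Longrightarrow> n \<bullet> v j = 0"
    "\<And>x. x = (x \<bullet> n) *\<^sub>R n + (\<Sum>j\<in>{1..<CARD('n)}. (x \<bullet> v j) *\<^sub>R v j)"
proof -
  let ?J = "{1..<CARD('n)}"
  have v: "v j \<bullet> v j = 1" "v j \<noteq> 0" if "j \<in> ?J" for j
  proof -
    have "norm (v j) = 1" using assms that by (simp add: orthonormal_tuples_def)
    then show "v j \<bullet> v j = 1" "v j \<noteq> 0" by (auto simp: norm_eq_1)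
  qed
  have vo: "v i \<bullet> v j = 0" if "i \<in> ?J" "j \<in> ?J" "i \<noteq> j" for i j
    using assms that by (auto simp: orthonormal_tuples_def pairwise_def orthogonal_def)
  have inj: "inj_on v ?J" by (metis inj_onI v(1) vo zero_neq_one)
  have "dim (v ` ?J) \<le> card (v ` ?J)" by (rule dim_le_card') simp
  also have "\<dots> < DIM(real^'n)"
    using card_image[OF inj] zero_less_card_finite[where 'a='n] by simp
  finally obtain m where m: "m \<noteq> 0" "\<And>y. y \<in> span (v ` ?J) \<Longrightarrow> orthogonal m y"
    using orthogonal_to_subspace_exists by blast
  define n where "n = (1 / norm m) *\<^sub>R m"
  have n: "norm n = 1" using m(1) by (simp add: n_def)
  then have n': "n \<bullet> n = 1" "n \<noteq> 0" by (auto simp: norm_eq_1)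
  have nv: "n \<bullet> v j = 0" if "j \<in> ?J" for j
    using m(2)[of "v j"] that by (auto simp: n_def orthogonal_def span_base)
  have complete: "x = (x \<bullet> n) *\<^sub>R n + (\<Sum>j\<in>?J. (x \<bullet> v j) *\<^sub>R v j)" for x
  proof (rule ccontr)
    define r where "r = x - ((x \<bullet> n) *\<^sub>R n + (\<Sum>j\<in>?J. (x \<bullet> v j) *\<^sub>R v j))"
    assume "x \<noteq> (x \<bullet> n) *\<^sub>R n + (\<Sum>j\<in>?J. (x \<bullet> v j) *\<^sub>R v j)"
    then have r0: "r \<noteq> 0" by (simp add: r_def)
    have rn: "r \<bullet> n = 0"
      using n' nv by (simp add: r_def inner_diff_left inner_add_left inner_sum_left inner_commute[of "v _" n])
    have rv: "r \<bullet> v i = 0" if i: "i \<in> ?J" for i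
    proof -
      have "(\<Sum>j\<in>?J. (x \<bullet> v j) * (v j \<bullet> v i)) = (\<Sum>j\<in>?J. if j = i then x \<bullet> v i else 0)"
        using i v vo by (intro sum.cong) auto
      also have "\<dots> = x \<bullet> v i" using i by simp
      finally show ?thesis
        using nv[OF i] by (simp add: r_def inner_diff_left inner_add_left inner_sum_left)
    qed
    let ?S = "insert r (insert n (v ` ?J))"
    have rv': "r \<bullet> y = 0" "n \<bullet> y = 0" "y \<noteq> 0" if "y \<in> v ` ?J" for y
      using that rv nv v(2) by auto
    have "pairwise orthogonal (v ` ?J)"
    proof (rule pairwiseI)
      fix y z assume "y \<in> v ` ?J" "z \<in> v ` ?J" "y \<noteq> z"
      then obtain i j where "i \<in> ?J" "j \<in> ?J" "y = v i" "z = v j" "i \<noteq> j" by blast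
      then show "orthogonal y z" using vo[of i j] by (simp add: orthogonal_def)
    qed
    then have "pairwise orthogonal ?S"
      using rn rv' unfolding pairwise_insert orthogonal_def
      by (metis inner_commute insertE)
    moreover have "0 \<notin> ?S" using r0 n'(2) rv'(3) by (metis insertE)
    ultimately have "independent ?S" by (rule pairwise_orthogonal_independent)
    then have "card ?S \<le> CARD('n)" using independent_bound[of ?S] by simp
    moreover have "n \<notin> v ` ?J" using n' rv'(2) by force
    moreover have "r \<notin> insert n (v ` ?J)" using rn rv'(1) r0 by (metis insertE inner_eq_zero_iff)
    ultimately have "card (v ` ?J) + 2 \<le> CARD('n)" by simp
    then show False
      using card_image[OF inj] by simp
  qed
  show thesis using that n nv complete by blast
qed

lemma trace_eq_sum_orthonormal:
  fixes X :: "real^'n^'n"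
  assumes "finite J" and complete: "\<And>x. x = (\<Sum>j\<in>J. (x \<bullet> w j) *\<^sub>R w j)"
  shows "trace X = (\<Sum>j\<in>J. w j \<bullet> (X *v w j))"
proof -
  have "trace X = (\<Sum>i\<in>UNIV. axis i 1 \<bullet> (X *v axis i 1))"
    by (simp add: trace_def inner_axis' matrix_vector_mult_basis column_def)
  also have "\<dots> = (\<Sum>i\<in>UNIV. \<Sum>j\<in>J. w j $ i * (w j \<bullet> (X *v axis i 1)))"
    by (subst complete[of "axis _ _"]) (simp add: inner_sum_left inner_axis')
  also have "\<dots> = (\<Sum>j\<in>J. \<Sum>i\<in>UNIV. w j $ i * (w j \<bullet> (X *v axis i 1)))"
    by (rule sum.swap)
  also have "\<dots> = (\<Sum>j\<in>J. w j \<bullet> (X *v w j))"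
  proof (rule sum.cong[OF refl])
    fix j
    have "X *v w j = X *v (\<Sum>i\<in>UNIV. w j $ i *\<^sub>R axis i 1)"
      using basis_expansion[of "w j"] by (simp add: scalar_mult_eq_scaleR)
    also have "\<dots> = (\<Sum>i\<in>UNIV. w j $ i *\<^sub>R (X *v axis i 1))"
      by (simp add: linear_sum[OF matrix_vector_mul_linear] matrix_vector_mult_scaleR)
    finally show "(\<Sum>i\<in>UNIV. w j $ i * (w j \<bullet> (X *v axis i 1))) = w j \<bullet> (X *v w j)"
      by (simp add: inner_sum_right)
  qed
  finally show ?thesis .
qed

lemma mcf_operator_eq:
  "mcf_operator p X = (p \<bullet> (X *v p)) / (norm p)\<^sup>2 - trace X"
proof -
  have "trace ((c *\<^sub>R outer_product p p) ** X) = c * (p \<bullet> (X *v p))" for c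
  proof -
    have "trace ((c *\<^sub>R outer_product p p) ** X)
        = (\<Sum>i\<in>UNIV. \<Sum>k\<in>UNIV. c * (p $ k * (X $ k $ i * p $ i)))"
      by (simp add: trace_def matrix_matrix_mult_def outer_product_def mult_ac)
    also have "\<dots> = (\<Sum>k\<in>UNIV. \<Sum>i\<in>UNIV. c * (p $ k * (X $ k $ i * p $ i)))"
      by (rule sum.swap)
    also have "\<dots> = c * (p \<bullet> (X *v p))"
      by (simp add: inner_vec_def matrix_vector_mult_def sum_distrib_left)
    finally show ?thesis .
  qed
  moreover have diff: "(mat 1 - M) ** X = X - M ** X" for M :: "real^'a^'a"
    using matrix_mul_lid[of X]
    by (simp add: matrix_matrix_mult_def vec_eq_iff left_diff_distrib sum_subtractf)
  ultimately show ?thesis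
    by (simp add: mcf_operator_def diff trace_sub)
qed

text \<open>
In the basis formed by \<open>n\<close> and the tuple, the projection in the operator removes exactly the \<open>n\<close>-entry
of the diagonal from the trace.
\<close>

lemma mcf_operator_along_normal:
  fixes v :: "nat \<Rightarrow> real^'n"
  assumes n: "norm n = 1"
    and complete: "\<And>x. x = (x \<bullet> n) *\<^sub>R n + (\<Sum>j\<in>{1..<CARD('n)}. (x \<bullet> v j) *\<^sub>R v j)"
    and "c \<noteq> 0"
  shows "mcf_operator (c *\<^sub>R n) X = - (\<Sum>j\<in>{1..<CARD('n)}. v j \<bullet> (X *v v j))"
proof -
  let ?w = "v(0 := n)"
  have sum: "(\<Sum>j\<in>insert 0 {1..<CARD('n)}. f (?w j)) = f n + (\<Sum>j\<in>{1..<CARD('n)}. f (v j))"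
    for f :: "real^'n \<Rightarrow> 'b::comm_monoid_add" by simp
  have "trace X = (\<Sum>j\<in>insert 0 {1..<CARD('n)}. ?w j \<bullet> (X *v ?w j))"
    using complete by (intro trace_eq_sum_orthonormal) (auto simp: sum)
  also have "\<dots> = n \<bullet> (X *v n) + (\<Sum>j\<in>{1..<CARD('n)}. v j \<bullet> (X *v v j))" by simp
  finally show ?thesis using n \<open>c \<noteq> 0\<close>
    by (simp add: mcf_operator_eq matrix_vector_mult_scaleR power2_eq_square)
qed

lemma envelope_bounds_of_sequence:
  assumes "q \<longlonglongrightarrow> z" "\<And>m. q m \<in> D" "\<And>m. f (q m) = c"
  shows "lsc_envelope D f z \<le> c" "c \<le> usc_envelope D f z"
proof -
  have q: "filtermap q sequentially \<le> inf (nhds z) (principal D)"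
    using assms by (simp add: filterlim_def le_principal eventually_filtermap)
  have freq: "\<exists>x. P x \<and> f x = c" if "eventually P (inf (nhds z) (principal D))" for P
  proof -
    have "eventually P (filtermap q sequentially)" using q that by (auto simp: le_filter_def)
    then show ?thesis using assms(3) by (auto simp: eventually_filtermap eventually_sequentially)
  qed
  show "lsc_envelope D f z \<le> c" unfolding lsc_envelope_def
    using freq by (intro Liminf_least) (metis INF_lower mem_Collect_eq)
  show "c \<le> usc_envelope D f z" unfolding usc_envelope_def
    using freq by (intro Limsup_greatest) (metis SUP_upper mem_Collect_eq)
qed

text \<open>
The tuple may only be known to be orthogonal to \<open>p\<close>, and \<open>p\<close> may vanish, where the operator is
singular.  In either case \<open>p\<close> is a multiple of the unit normal \<open>n\<close>, hence a limit of nonzero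
multiples of \<open>n\<close>, along which the operator is constantly \<open>- \<Sum>\<^sub>j v\<^sub>j\<bullet>X v\<^sub>j\<close>.
\<close>

lemma mcf_envelope_bounds:
  fixes X :: "real^'n^'n"
  assumes v: "v \<in> orthonormal_tuples" and "transpose X = X"
    and orth: "\<And>j. j \<in> {1..<CARD('n)} \<Longrightarrow> p \<bullet> v j = 0"
  shows "mcf_operator_lsc p X \<le> ereal (- (\<Sum>j\<in>{1..<CARD('n)}. v j \<bullet> (X *v v j)))"
    and "ereal (- (\<Sum>j\<in>{1..<CARD('n)}. v j \<bullet> (X *v v j))) \<le> mcf_operator_usc p X"
proof -
  obtain n where n: "norm n = 1" "\<And>j. j \<in> {1..<CARD('n)} \<Longrightarrow> n \<bullet> v j = 0"
    "\<And>x. x = (x \<bullet> n) *\<^sub>R n + (\<Sum>j\<in>{1..<CARD('n)}. (x \<bullet> v j) *\<^sub>R v j)"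
    using orthonormal_tuple_normal[OF v] by blast
  have p: "p = (p \<bullet> n) *\<^sub>R n" using n(3)[of p] orth by simp
  \<comment> \<open>The coefficient of the normal is moved away from zero, on the side on which it already lies.\<close>
  define s :: real where "s = (if p \<bullet> n \<ge> 0 then 1 else -1)"
  define c where "c m = s * (\<bar>p \<bullet> n\<bar> + inverse (real (Suc m)))" for m
  have "\<bar>p \<bullet> n\<bar> + inverse (real (Suc m)) > 0" for m by (intro add_nonneg_pos) auto
  then have c0: "c m \<noteq> 0" for m by (metis c_def s_def mult_eq_0_iff less_irrefl zero_neq_one neg_equal_0_iff_equal)
  have "c \<longlonglongrightarrow> s * (\<bar>p \<bullet> n\<bar> + 0)"
    unfolding c_def by (intro tendsto_intros LIMSEQ_inverse_real_of_nat)
  then have "c \<longlonglongrightarrow> p \<bullet> n" by (simp add: s_def split: if_splits)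
  then have "(\<lambda>m. (c m *\<^sub>R n, X)) \<longlonglongrightarrow> ((p \<bullet> n) *\<^sub>R n, X)" by (intro tendsto_intros)
  then have lim: "(\<lambda>m. (c m *\<^sub>R n, X)) \<longlonglongrightarrow> (p, X)" using p by simp
  have "n \<noteq> 0" using n(1) by auto
  then have dom: "(c m *\<^sub>R n, X) \<in> mcf_domain" for m using c0 assms(2) by (auto simp: mcf_domain_def)
  have val: "(case (c m *\<^sub>R n, X) of (q, Y) \<Rightarrow> ereal (mcf_operator q Y))
      = ereal (- (\<Sum>j\<in>{1..<CARD('n)}. v j \<bullet> (X *v v j)))" for m
    using mcf_operator_along_normal[OF n(1,3) c0] by simp
  show "mcf_operator_lsc p X \<le> ereal (- (\<Sum>j\<in>{1..<CARD('n)}. v j \<bullet> (X *v v j)))"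
    "ereal (- (\<Sum>j\<in>{1..<CARD('n)}. v j \<bullet> (X *v v j))) \<le> mcf_operator_usc p X"
    unfolding mcf_operator_lsc_def mcf_operator_usc_def
    by (rule envelope_bounds_of_sequence[of "\<lambda>m. (c m *\<^sub>R n, X)"]; rule lim dom val)+
qed

section \<open>The dynamic programming principle\<close>

abbreviation sign_choices :: "'n::finite itself \<Rightarrow> (nat \<Rightarrow> real) set" where
  "sign_choices _ \<equiv> {1..<CARD('n)} \<rightarrow>\<^sub>E {-1, 1}"

definition displacement :: "(nat \<Rightarrow> real^'n) \<Rightarrow> (nat \<Rightarrow> real) \<Rightarrow> real^'n" where
  "displacement v b = (\<Sum>j\<in>{1..<CARD('n)}. b j *\<^sub>R v j)"

lemma sign_choices_finite_nonempty:
  "finite (sign_choices TYPE('n::finite))" "sign_choices TYPE('n) \<noteq> {}"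
  by (auto simp: PiE_eq_empty_iff intro!: finite_PiE)

lemma game_value_stopped: "t \<le> 0 \<Longrightarrow> game_value \<Psi> u0 \<epsilon> x t = u0 x"
  by (simp add: game_value.simps)

lemma game_value_round:
  fixes x :: "real^'n"
  assumes "t > 0" "\<epsilon> > 0"
  shows "game_value \<Psi> u0 \<epsilon> x t = max (\<Psi> x)
    (SUP v\<in>orthonormal_tuples. MIN b\<in>sign_choices TYPE('n).
       game_value \<Psi> u0 \<epsilon> (x + (sqrt 2 * \<epsilon>) *\<^sub>R displacement v b) (t - \<epsilon>\<^sup>2))"
  using assms by (subst game_value.simps) (simp add: displacement_def)

text \<open>
Induction on the number of rounds left to play.
\<close>

lemma game_induct [consumes 1, case_names stopped round]:
  fixes P :: "'a \<Rightarrow> real \<Rightarrow> bool" and \<epsilon> :: real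
  assumes "\<epsilon> > 0" and stopped: "\<And>x t. t \<le> 0 \<Longrightarrow> P x t"
    and round: "\<And>x t. t > 0 \<Longrightarrow> (\<And>y. P y (t - \<epsilon>\<^sup>2)) \<Longrightarrow> P x t"
  shows "P x t"
proof -
  have "\<forall>x t. t \<le> real k * \<epsilon>\<^sup>2 \<longrightarrow> P x t" for k
  proof (induction k)
    case 0
    then show ?case using stopped by simp
  next
    case (Suc k)
    show ?case
    proof (intro allI impI)
      fix x t assume "t \<le> real (Suc k) * \<epsilon>\<^sup>2"
      then have "P y (t - \<epsilon>\<^sup>2)" for y using Suc by (auto simp: algebra_simps)
      then show "P x t" using stopped[of t x] round[of t x] by (cases "t \<le> 0") auto
    qed
  qed
  moreover obtain k where "t / \<epsilon>\<^sup>2 \<le> real k" using real_arch_simple by blast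
  then have "t \<le> real k * \<epsilon>\<^sup>2" using \<open>\<epsilon> > 0\<close> by (simp add: pos_divide_le_eq)
  ultimately show ?thesis by blast
qed

lemma sign_choices_uminus:
  assumes "b \<in> sign_choices TYPE('n::finite)"
  shows "restrict (\<lambda>j. - b j) {1..<CARD('n)} \<in> sign_choices TYPE('n)"
  using assms by (auto simp: PiE_iff)

lemma displacement_uminus:
  fixes v :: "nat \<Rightarrow> real^'n"
  shows "displacement v (restrict (\<lambda>j. - b j) {1..<CARD('n)}) = - displacement v b"
  by (simp add: displacement_def sum_negf)

lemma orthonormal_tuples_nonempty: "(orthonormal_tuples :: (nat \<Rightarrow> real^'n) set) \<noteq> {}"
  using orthonormal_tuple_diagonalizing[of "(\<bullet>) :: real^'n \<Rightarrow> _" 0]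
  by (auto simp: bilinear_conv_bounded_bilinear bounded_bilinear_inner inner_commute)

locale game =
  fixes \<Psi> u0 :: "real^'n \<Rightarrow> real" and m M :: real
  assumes obstacle_le: "\<Psi> x \<le> u0 x" and payoff_bounds: "m \<le> u0 x" "u0 x \<le> M"
begin

abbreviation worst_outcome :: "real \<Rightarrow> real^'n \<Rightarrow> real \<Rightarrow> (nat \<Rightarrow> real^'n) \<Rightarrow> real" where
  "worst_outcome \<epsilon> x t v \<equiv> MIN b\<in>sign_choices TYPE('n).
     game_value \<Psi> u0 \<epsilon> (x + (sqrt 2 * \<epsilon>) *\<^sub>R displacement v b) (t - \<epsilon>\<^sup>2)"

lemma worst_outcome_le:
  "b \<in> sign_choices TYPE('n) \<Longrightarrow>
   worst_outcome \<epsilon> x t v \<le> game_value \<Psi> u0 \<epsilon> (x + (sqrt 2 * \<epsilon>) *\<^sub>R displacement v b) (t - \<epsilon>\<^sup>2)"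
  using sign_choices_finite_nonempty[where 'n='n] by (intro Min_le) auto

lemma worst_outcome_attained:
  obtains b where "b \<in> sign_choices TYPE('n)"
    "worst_outcome \<epsilon> x t v = game_value \<Psi> u0 \<epsilon> (x + (sqrt 2 * \<epsilon>) *\<^sub>R displacement v b) (t - \<epsilon>\<^sup>2)"
proof -
  have "worst_outcome \<epsilon> x t v \<in>
      (\<lambda>b. game_value \<Psi> u0 \<epsilon> (x + (sqrt 2 * \<epsilon>) *\<^sub>R displacement v b) (t - \<epsilon>\<^sup>2)) ` sign_choices TYPE('n)"
    using sign_choices_finite_nonempty[where 'n='n] by (intro Min_in) auto
  then show thesis using that by blast
qed

lemma obstacle_le_game_value: "\<Psi> x \<le> game_value \<Psi> u0 \<epsilon> x t"
proof (cases "t \<le> 0 \<or> \<epsilon> \<le> 0")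
  case True
  then show ?thesis using obstacle_le[of x] by (simp add: game_value.simps)
next
  case False
  then show ?thesis by (simp add: game_value_round)
qed

text \<open>
Comparison with a supersolution of the dynamic programming principle: against every tuple the second
player has an answer along which \<open>f\<close> does not increase.
\<close>

lemma game_value_upper_induct:
  assumes "\<epsilon> > 0" and base: "\<And>y s. s \<le> 0 \<Longrightarrow> u0 y \<le> f y s"
    and obst: "\<And>y s. s > 0 \<Longrightarrow> \<Psi> y \<le> f y s"
    and round: "\<And>y s v. s > 0 \<Longrightarrow> v \<in> orthonormal_tuples \<Longrightarrow>
      \<exists>b\<in>sign_choices TYPE('n). f (y + (sqrt 2 * \<epsilon>) *\<^sub>R displacement v b) (s - \<epsilon>\<^sup>2) \<le> f y s"
  shows "game_value \<Psi> u0 \<epsilon> x t \<le> f x t"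
  using \<open>\<epsilon> > 0\<close>
proof (induction x t rule: game_induct)
  case (stopped x t)
  then show ?case using base by (simp add: game_value_stopped)
next
  case (round x t)
  have "worst_outcome \<epsilon> x t v \<le> f x t" if "v \<in> orthonormal_tuples" for v
    using assms(4)[OF round(1) that, of x] worst_outcome_le round(2) by (meson order_trans)
  then have "(SUP v\<in>orthonormal_tuples. worst_outcome \<epsilon> x t v) \<le> f x t"
    using orthonormal_tuples_nonempty by (intro cSUP_least) auto
  then show ?case using obst round(1) \<open>\<epsilon> > 0\<close> by (simp add: game_value_round)
qed

lemma game_value_le_bound:
  assumes "\<epsilon> > 0"
  shows "game_value \<Psi> u0 \<epsilon> x t \<le> M"
proof -
  have "\<exists>b. b \<in> sign_choices TYPE('n)" using sign_choices_finite_nonempty(2)[where 'n='n] by blast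
  then show ?thesis
    using payoff_bounds order_trans[OF obstacle_le]
    by (intro game_value_upper_induct[where f="\<lambda>_ _. M"]) (auto simp: assms)
qed

text \<open>
This lower half of the dynamic programming principle needs the upper bound on the value: the
supremum of reals dominates its members only if it is over a bounded set.
\<close>

lemma game_value_ge_outcome:
  assumes "\<epsilon> > 0" "t > 0" "v \<in> orthonormal_tuples"
  obtains b where "b \<in> sign_choices TYPE('n)"
    "game_value \<Psi> u0 \<epsilon> (x + (sqrt 2 * \<epsilon>) *\<^sub>R displacement v b) (t - \<epsilon>\<^sup>2) \<le> game_value \<Psi> u0 \<epsilon> x t"
proof -
  obtain b0 where b0: "b0 \<in> sign_choices TYPE('n)"
    using sign_choices_finite_nonempty(2)[where 'n='n] by blast
  have "bdd_above (worst_outcome \<epsilon> x t ` orthonormal_tuples)"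
    using order_trans[OF worst_outcome_le[OF b0] game_value_le_bound[OF assms(1)]]
    by (intro bdd_aboveI2[where M=M]) auto
  then have "worst_outcome \<epsilon> x t v \<le> (SUP v\<in>orthonormal_tuples. worst_outcome \<epsilon> x t v)"
    using assms(3) by (rule cSUP_upper[rotated])
  then have "worst_outcome \<epsilon> x t v \<le> game_value \<Psi> u0 \<epsilon> x t"
    using assms by (simp add: game_value_round)
  then show thesis using worst_outcome_attained[of \<epsilon> x v t] that by metis
qed

text \<open>
Comparison with a subsolution: the first player has, at every position, a tuple along which \<open>f\<close> does not
decrease whatever the signs.
\<close>

lemma game_value_lower_induct:
  assumes "\<epsilon> > 0" and base: "\<And>y s. s \<le> 0 \<Longrightarrow> f y s \<le> u0 y"
    and round: "\<And>y s. s > 0 \<Longrightarrow> \<exists>v\<in>orthonormal_tuples. \<forall>b\<in>sign_choices TYPE('n).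
        f y s \<le> f (y + (sqrt 2 * \<epsilon>) *\<^sub>R displacement v b) (s - \<epsilon>\<^sup>2)"
  shows "f x t \<le> game_value \<Psi> u0 \<epsilon> x t"
  using \<open>\<epsilon> > 0\<close>
proof (induction x t rule: game_induct)
  case (stopped x t)
  then show ?case using base by (simp add: game_value_stopped)
next
  case (round x t)
  obtain v where v: "v \<in> orthonormal_tuples"
    "\<And>b. b \<in> sign_choices TYPE('n) \<Longrightarrow> f x t \<le> f (x + (sqrt 2 * \<epsilon>) *\<^sub>R displacement v b) (t - \<epsilon>\<^sup>2)"
    using assms(3)[OF round(1), of x] by blast
  obtain b where "b \<in> sign_choices TYPE('n)"
    "game_value \<Psi> u0 \<epsilon> (x + (sqrt 2 * \<epsilon>) *\<^sub>R displacement v b) (t - \<epsilon>\<^sup>2) \<le> game_value \<Psi> u0 \<epsilon> x t"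
    by (rule game_value_ge_outcome[OF \<open>\<epsilon> > 0\<close> round(1) v(1)])
  then show ?case using v(2)[of b] round(2)[of "x + (sqrt 2 * \<epsilon>) *\<^sub>R displacement v b"] by linarith
qed

lemma game_value_ge_bound:
  assumes "\<epsilon> > 0"
  shows "m \<le> game_value \<Psi> u0 \<epsilon> x t"
  using payoff_bounds orthonormal_tuples_nonempty
  by (intro game_value_lower_induct[where f="\<lambda>_ _. m"]) (auto simp: assms)

lemma game_value_near_optimal:
  assumes "\<epsilon> > 0" "t > 0" "\<Psi> x < game_value \<Psi> u0 \<epsilon> x t" "\<delta> > 0"
  obtains v where "v \<in> orthonormal_tuples"
    "\<And>b. b \<in> sign_choices TYPE('n) \<Longrightarrow> game_value \<Psi> u0 \<epsilon> x t
       \<le> game_value \<Psi> u0 \<epsilon> (x + (sqrt 2 * \<epsilon>) *\<^sub>R displacement v b) (t - \<epsilon>\<^sup>2) + \<delta>"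
proof -
  have "game_value \<Psi> u0 \<epsilon> x t = (SUP v\<in>orthonormal_tuples. worst_outcome \<epsilon> x t v)"
    using assms by (simp add: game_value_round max_def split: if_splits)
  then have "game_value \<Psi> u0 \<epsilon> x t - \<delta> < (SUP v\<in>orthonormal_tuples. worst_outcome \<epsilon> x t v)"
    using assms by simp
  from less_cSupD[OF _ this] obtain v
    where v: "v \<in> orthonormal_tuples" "game_value \<Psi> u0 \<epsilon> x t - \<delta> < worst_outcome \<epsilon> x t v"
    using orthonormal_tuples_nonempty by auto
  then show thesis using that[of v] worst_outcome_le[of _ \<epsilon> x v t] by (smt (verit))
qed

section \<open>Quadratic barriers at the initial time\<close>

definition displacement_sqnorm :: real where
  "displacement_sqnorm = real (CARD('n) - 1)"

lemma norm_displacement_square: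
  fixes v :: "nat \<Rightarrow> real^'n"
  assumes v: "v \<in> orthonormal_tuples" and b: "b \<in> sign_choices TYPE('n)"
  shows "(norm (displacement v b))\<^sup>2 = displacement_sqnorm"
proof -
  have v': "v i \<bullet> v i = 1" if "i \<in> {1..<CARD('n)}" for i
    using v that unfolding orthonormal_tuples_def by (simp add: norm_eq_1[symmetric])
  have "displacement v b \<bullet> displacement v b = (\<Sum>j\<in>{1..<CARD('n)}. v j \<bullet> v j)"
    unfolding displacement_def
    using v b by (intro quadratic_form_of_diagonal_signs)
      (auto simp: bilinear_conv_bounded_bilinear bounded_bilinear_inner PiE_iff
        orthonormal_tuples_def pairwise_def orthogonal_def)
  also have "\<dots> = displacement_sqnorm" using v' by (simp add: displacement_sqnorm_def)
  finally show ?thesis by (simp add: power2_norm_eq_inner)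
qed

text \<open>
The second player picks, among \<open>b\<close> and \<open>-b\<close>, the signs for which the cross term
\<open>(y - x)\<bullet>S\<close> is not positive.  The barrier then pays for the growth \<open>2 \<epsilon>\<^sup>2 (d - 1)\<close> of \<open>|y - x|\<^sup>2\<close> with
the elapsed time \<open>\<epsilon>\<^sup>2\<close>.  The shift by \<open>\<epsilon>\<^sup>2\<close> inside the maximum absorbs the last round, which may end
at a negative time.
\<close>

lemma game_value_upper_barrier:
  assumes "\<epsilon> > 0" "C \<ge> 0" and u0: "\<And>y. u0 y \<le> A + C * (norm (y - x))\<^sup>2"
  shows "game_value \<Psi> u0 \<epsilon> y s
    \<le> A + C * (norm (y - x))\<^sup>2 + 2 * C * displacement_sqnorm * max (s + \<epsilon>\<^sup>2) 0"
  using \<open>\<epsilon> > 0\<close>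
proof (rule game_value_upper_induct)
  fix y s v assume s: "s > (0::real)" and v: "v \<in> (orthonormal_tuples :: (nat \<Rightarrow> real^'n) set)"
  obtain b0 where b0: "b0 \<in> sign_choices TYPE('n)"
    using sign_choices_finite_nonempty(2)[where 'n='n] by blast
  obtain b where b: "b \<in> sign_choices TYPE('n)" "(y - x) \<bullet> displacement v b \<le> 0"
  proof (cases "(y - x) \<bullet> displacement v b0 \<le> 0")
    case False
    then show thesis
      using that[OF sign_choices_uminus[OF b0]] unfolding displacement_uminus by simp
  qed (use that b0 in blast)
  let ?h = "displacement v b"
  have "(norm (y + (sqrt 2 * \<epsilon>) *\<^sub>R ?h - x))\<^sup>2
      = (norm (y - x))\<^sup>2 + 2 * (sqrt 2 * \<epsilon>) * ((y - x) \<bullet> ?h) + 2 * \<epsilon>\<^sup>2 * displacement_sqnorm"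
    unfolding norm_displacement_square[OF v b(1), symmetric] power2_norm_eq_inner
    by (simp add: inner_add_left inner_add_right inner_diff_left inner_diff_right inner_commute
        algebra_simps power2_eq_square)
  also have "\<dots> \<le> (norm (y - x))\<^sup>2 + 2 * \<epsilon>\<^sup>2 * displacement_sqnorm"
    using b(2) \<open>\<epsilon> > 0\<close> by (simp add: mult_nonneg_nonpos)
  finally have "C * (norm (y + (sqrt 2 * \<epsilon>) *\<^sub>R ?h - x))\<^sup>2
      \<le> C * ((norm (y - x))\<^sup>2 + 2 * \<epsilon>\<^sup>2 * displacement_sqnorm)"
    using \<open>C \<ge> 0\<close> by (rule mult_left_mono)
  moreover have max: "max (s - \<epsilon>\<^sup>2 + \<epsilon>\<^sup>2) 0 = s" "max (s + \<epsilon>\<^sup>2) 0 = s + \<epsilon>\<^sup>2"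
    using s zero_le_power2[of \<epsilon>] by linarith+
  ultimately show "\<exists>b\<in>sign_choices TYPE('n).
      A + C * (norm (y + (sqrt 2 * \<epsilon>) *\<^sub>R displacement v b - x))\<^sup>2
        + 2 * C * displacement_sqnorm * max (s - \<epsilon>\<^sup>2 + \<epsilon>\<^sup>2) 0
      \<le> A + C * (norm (y - x))\<^sup>2 + 2 * C * displacement_sqnorm * max (s + \<epsilon>\<^sup>2) 0"
    using max by (intro bexI[OF _ b(1)]) (simp add: algebra_simps)
next
  fix y s
  have le: "u0 y \<le> A + C * (norm (y - x))\<^sup>2 + 2 * C * displacement_sqnorm * max (s + \<epsilon>\<^sup>2) 0"
    using u0[of y] \<open>C \<ge> 0\<close> by (smt (verit) mult_nonneg_nonneg of_nat_0_le_iff displacement_sqnorm_def)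
  then show "u0 y \<le> A + C * (norm (y - x))\<^sup>2 + 2 * C * displacement_sqnorm * max (s + \<epsilon>\<^sup>2) 0" .
  show "\<Psi> y \<le> A + C * (norm (y - x))\<^sup>2 + 2 * C * displacement_sqnorm * max (s + \<epsilon>\<^sup>2) 0"
    using le obstacle_le[of y] by linarith
qed

text \<open>
Here the first player removes the cross term by playing orthogonally to \<open>y - x\<close>.
\<close>

lemma game_value_lower_barrier:
  assumes "\<epsilon> > 0" "C \<ge> 0" and u0: "\<And>y. A - C * (norm (y - x))\<^sup>2 \<le> u0 y"
  shows "A - C * (norm (y - x))\<^sup>2 - 2 * C * displacement_sqnorm * max (s + \<epsilon>\<^sup>2) 0
    \<le> game_value \<Psi> u0 \<epsilon> y s"
  using \<open>\<epsilon> > 0\<close>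
proof (rule game_value_lower_induct)
  fix y s assume s: "s > (0::real)"
  obtain v where v: "v \<in> (orthonormal_tuples :: (nat \<Rightarrow> real^'n) set)"
    "\<And>j. j \<in> {1..<CARD('n)} \<Longrightarrow> v j \<bullet> (y - x) = 0"
    using orthonormal_tuple_diagonalizing[of "(\<bullet>) :: real^'n \<Rightarrow> _" "y - x"]
    by (auto simp: bilinear_conv_bounded_bilinear bounded_bilinear_inner inner_commute)
  have "(norm (y + (sqrt 2 * \<epsilon>) *\<^sub>R displacement v b - x))\<^sup>2
      = (norm (y - x))\<^sup>2 + 2 * \<epsilon>\<^sup>2 * displacement_sqnorm" if b: "b \<in> sign_choices TYPE('n)" for b
  proof -
    have "(y - x) \<bullet> displacement v b = 0"
      unfolding displacement_def using v(2) by (simp add: inner_sum_right inner_commute)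
    moreover have "(norm (y + (sqrt 2 * \<epsilon>) *\<^sub>R displacement v b - x))\<^sup>2
      = (norm (y - x))\<^sup>2 + 2 * (sqrt 2 * \<epsilon>) * ((y - x) \<bullet> displacement v b)
        + 2 * \<epsilon>\<^sup>2 * displacement_sqnorm"
      unfolding norm_displacement_square[OF v(1) b, symmetric] power2_norm_eq_inner
      by (simp add: inner_add_left inner_add_right inner_diff_left inner_diff_right inner_commute
          algebra_simps power2_eq_square)
    ultimately show ?thesis by simp
  qed
  moreover have max: "max (s - \<epsilon>\<^sup>2 + \<epsilon>\<^sup>2) 0 = s" "max (s + \<epsilon>\<^sup>2) 0 = s + \<epsilon>\<^sup>2"
    using s zero_le_power2[of \<epsilon>] by linarith+
  ultimately show "\<exists>v\<in>orthonormal_tuples. \<forall>b\<in>sign_choices TYPE('n).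
      A - C * (norm (y - x))\<^sup>2 - 2 * C * displacement_sqnorm * max (s + \<epsilon>\<^sup>2) 0
      \<le> A - C * (norm (y + (sqrt 2 * \<epsilon>) *\<^sub>R displacement v b - x))\<^sup>2
        - 2 * C * displacement_sqnorm * max (s - \<epsilon>\<^sup>2 + \<epsilon>\<^sup>2) 0"
    using max by (intro bexI[OF _ v(1)]) (simp add: algebra_simps)
next
  fix y s
  show "A - C * (norm (y - x))\<^sup>2 - 2 * C * displacement_sqnorm * max (s + \<epsilon>\<^sup>2) 0 \<le> u0 y"
    using u0[of y] \<open>C \<ge> 0\<close> by (smt (verit) mult_nonneg_nonneg of_nat_0_le_iff displacement_sqnorm_def)
qed

end

section \<open>Second-order expansions of test functions\<close>

definition dir_deriv :: "('a::euclidean_space \<Rightarrow> real) \<Rightarrow> 'a \<Rightarrow> 'a \<Rightarrow> real" where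
  "dir_deriv f v z = frechet_derivative f (at z) v"

lemma dir_deriv_along_line:
  assumes "f differentiable at (z + \<tau> *\<^sub>R w)"
  shows "((\<lambda>\<tau>. f (z + \<tau> *\<^sub>R w)) has_real_derivative dir_deriv f w (z + \<tau> *\<^sub>R w)) (at \<tau>)"
proof -
  let ?f' = "frechet_derivative f (at (z + \<tau> *\<^sub>R w))"
  have f': "(f has_derivative ?f') (at (z + \<tau> *\<^sub>R w))" using assms by (simp add: frechet_derivative_works)
  have "((\<lambda>\<tau>. z + \<tau> *\<^sub>R w) has_derivative (\<lambda>h. h *\<^sub>R w)) (at \<tau>)"
    by (auto intro!: derivative_eq_intros)
  from has_derivative_compose[OF this f'] show ?thesis
    unfolding has_field_derivative_def dir_deriv_def
    using linear_scale[OF linear_frechet_derivative[OF assms]]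
    by (simp add: mult_commute_abs)
qed

text \<open>
The mean value theorem in the direction \<open>u\<close>, applied to the difference in the direction \<open>v\<close>, and then
in the direction \<open>v\<close>.  The left-hand side is symmetric in \<open>u\<close> and \<open>v\<close>, which makes mixed second
derivatives commute.
\<close>

lemma second_difference_mean_value:
  fixes f :: "'a::euclidean_space \<Rightarrow> real"
  assumes s: "s > 0"
    and diff: "\<And>\<xi> \<eta>. 0 \<le> \<xi> \<Longrightarrow> \<xi> \<le> s \<Longrightarrow> 0 \<le> \<eta> \<Longrightarrow> \<eta> \<le> s \<Longrightarrow>
      f differentiable at (z + \<xi> *\<^sub>R u + \<eta> *\<^sub>R v) \<and> dir_deriv f u differentiable at (z + \<xi> *\<^sub>R u + \<eta> *\<^sub>R v)"
  shows "\<exists>\<xi> \<eta>. 0 \<le> \<xi> \<and> \<xi> \<le> s \<and> 0 \<le> \<eta> \<and> \<eta> \<le> s \<and>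
    f (z + s *\<^sub>R u + s *\<^sub>R v) - f (z + s *\<^sub>R u) - f (z + s *\<^sub>R v) + f z
      = s\<^sup>2 * dir_deriv (dir_deriv f u) v (z + \<xi> *\<^sub>R u + \<eta> *\<^sub>R v)"
proof -
  define g where "g \<xi> = f (z + s *\<^sub>R v + \<xi> *\<^sub>R u) - f (z + \<xi> *\<^sub>R u)" for \<xi>
  define g' where "g' \<xi> = dir_deriv f u (z + s *\<^sub>R v + \<xi> *\<^sub>R u) - dir_deriv f u (z + \<xi> *\<^sub>R u)" for \<xi>
  have swap: "z + \<xi> *\<^sub>R u + \<eta> *\<^sub>R v = z + \<eta> *\<^sub>R v + \<xi> *\<^sub>R u" for \<xi> \<eta> by (simp add: algebra_simps)
  have "(g has_real_derivative g' \<xi>) (at \<xi>)" if "0 \<le> \<xi>" "\<xi> \<le> s" for \<xi>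
    unfolding g_def g'_def using diff[OF that, of s] diff[OF that, of 0] s
    by (intro DERIV_diff dir_deriv_along_line) (auto simp: swap)
  from MVT2[OF s this] obtain \<xi> where \<xi>: "0 < \<xi>" "\<xi> < s" "g s - g 0 = s * g' \<xi>" by auto
  have "((\<lambda>\<eta>. dir_deriv f u (z + \<xi> *\<^sub>R u + \<eta> *\<^sub>R v)) has_real_derivative
      dir_deriv (dir_deriv f u) v (z + \<xi> *\<^sub>R u + \<eta> *\<^sub>R v)) (at \<eta>)" if "0 \<le> \<eta>" "\<eta> \<le> s" for \<eta>
    using diff[of \<xi> \<eta>] that \<xi> by (intro dir_deriv_along_line) auto
  from MVT2[OF s this] obtain \<eta> where \<eta>: "0 < \<eta>" "\<eta> < s"
    "dir_deriv f u (z + \<xi> *\<^sub>R u + s *\<^sub>R v) - dir_deriv f u (z + \<xi> *\<^sub>R u + 0 *\<^sub>R v)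
      = s * dir_deriv (dir_deriv f u) v (z + \<xi> *\<^sub>R u + \<eta> *\<^sub>R v)" by auto
  have "f (z + s *\<^sub>R u + s *\<^sub>R v) - f (z + s *\<^sub>R u) - f (z + s *\<^sub>R v) + f z = g s - g 0"
    by (simp add: g_def swap)
  also have "\<dots> = s\<^sup>2 * dir_deriv (dir_deriv f u) v (z + \<xi> *\<^sub>R u + \<eta> *\<^sub>R v)"
    using \<xi>(3) \<eta>(3) unfolding g'_def by (simp add: swap[of \<xi> s] power2_eq_square)
  finally show ?thesis using \<xi> \<eta> by (intro exI[of _ \<xi>] exI[of _ \<eta>]) auto
qed

locale twice_cont_diff =
  fixes f :: "'a::euclidean_space \<Rightarrow> real" and S :: "'a set"
  assumes open_S: "open S" and C2: "k_times_cont_diff_on (Suc (Suc 0)) S f"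
begin

definition second_deriv :: "'a \<Rightarrow> 'a \<Rightarrow> 'a \<Rightarrow> real" where
  "second_deriv v w z = dir_deriv (dir_deriv f v) w z"

lemma differentiable: "z \<in> S \<Longrightarrow> f differentiable at z"
  using C2 by simp

lemma dir_deriv_differentiable: "z \<in> S \<Longrightarrow> dir_deriv f v differentiable at z"
  using C2 by (simp add: dir_deriv_def[abs_def])

lemma dir_deriv_isCont: "z \<in> S \<Longrightarrow> isCont (dir_deriv f v) z"
  by (intro differentiable_imp_continuous_within dir_deriv_differentiable)

lemma second_deriv_isCont: "z \<in> S \<Longrightarrow> isCont (second_deriv v w) z"
  using C2 open_S
  by (simp add: dir_deriv_def[abs_def] second_deriv_def[abs_def] continuous_on_eq_continuous_at)

lemma dir_deriv_linear: "z \<in> S \<Longrightarrow> linear (\<lambda>v. dir_deriv f v z)"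
  unfolding dir_deriv_def using linear_frechet_derivative[OF differentiable] by simp

lemma second_deriv_bilinear:
  assumes z: "z \<in> S"
  shows "bilinear (\<lambda>v w. second_deriv v w z)"
proof -
  have D: "(dir_deriv f v has_derivative (\<lambda>w. second_deriv v w z)) (at z)" for v
    using dir_deriv_differentiable[OF z, of v]
    unfolding second_deriv_def dir_deriv_def[of "dir_deriv f v"] frechet_derivative_works .
  have unique: "second_deriv v w z = g w"
    if "\<And>x. x \<in> S \<Longrightarrow> h x = dir_deriv f v x" "(h has_derivative g) (at z)" for v g h w
    using has_derivative_unique[OF has_derivative_transform_within_open[OF that(2) open_S z that(1)] D]
    by metis
  have "linear (\<lambda>w. second_deriv v w z)" for v
    using has_derivative_linear[OF D] .
  moreover have "linear (\<lambda>v. second_deriv v w z)" for w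
  proof (rule linearI)
    fix v v' :: 'a and c :: real
    show "second_deriv (v + v') w z = second_deriv v w z + second_deriv v' w z"
      by (rule unique[OF _ has_derivative_add[OF D D]]) (simp add: linear_add[OF dir_deriv_linear])
    show "second_deriv (c *\<^sub>R v) w z = c *\<^sub>R second_deriv v w z"
      by (rule unique[OF _ has_derivative_scaleR_right[OF D]]) (simp add: linear_scale[OF dir_deriv_linear])
  qed
  ultimately show ?thesis by (simp add: bilinear_def)
qed

text \<open>
Symmetry of the Hessian is needed because the envelopes of the operator are only
approached through symmetric matrices.
\<close>

lemma second_deriv_commute:
  assumes z: "z \<in> S"
  shows "second_deriv u v z = second_deriv v u z"
proof (rule ccontr)
  assume ne: "second_deriv u v z \<noteq> second_deriv v u z"
  define e where "e = \<bar>second_deriv u v z - second_deriv v u z\<bar> / 2"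
  have e: "e > 0" using ne by (simp add: e_def)
  obtain r where r: "r > 0" "ball z r \<subseteq> S" using open_S z openE by blast
  obtain d1 where d1: "d1 > 0" "\<And>x. dist x z < d1 \<Longrightarrow> dist (second_deriv u v x) (second_deriv u v z) < e"
    using second_deriv_isCont[OF z] e unfolding continuous_at_eps_delta by blast
  obtain d2 where d2: "d2 > 0" "\<And>x. dist x z < d2 \<Longrightarrow> dist (second_deriv v u x) (second_deriv v u z) < e"
    using second_deriv_isCont[OF z] e unfolding continuous_at_eps_delta by blast
  define d where "d = min r (min d1 d2)"
  define s where "s = d / (norm u + norm v + 1)"
  have d: "d > 0" using r d1 d2 by (simp add: d_def)
  have nz: "norm u + norm v + 1 > 0" by (intro add_nonneg_pos) auto
  have s: "s > 0" using d nz by (simp add: s_def)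
  have near: "dist (z + \<xi> *\<^sub>R a + \<eta> *\<^sub>R b) z < d"
    if "0 \<le> \<xi>" "\<xi> \<le> s" "0 \<le> \<eta>" "\<eta> \<le> s" "norm a + norm b = norm u + norm v" for \<xi> \<eta> a b
  proof -
    have "dist (z + \<xi> *\<^sub>R a + \<eta> *\<^sub>R b) z \<le> \<xi> * norm a + \<eta> * norm b"
      using norm_triangle_ineq[of "\<xi> *\<^sub>R a" "\<eta> *\<^sub>R b"] that
      by (simp add: dist_norm add.assoc)
    also have "\<dots> \<le> s * norm a + s * norm b"
      using that by (intro add_mono mult_right_mono) auto
    also have "\<dots> < s * (norm u + norm v + 1)"
      using that(5) s by (simp flip: distrib_left)
    also have "\<dots> = d" using nz by (simp add: s_def)
    finally show ?thesis .
  qed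
  have inS: "z + \<xi> *\<^sub>R a + \<eta> *\<^sub>R b \<in> S"
    if "0 \<le> \<xi>" "\<xi> \<le> s" "0 \<le> \<eta>" "\<eta> \<le> s" "norm a + norm b = norm u + norm v" for \<xi> \<eta> a b
    using near[OF that] r by (auto simp: d_def dist_commute)
  have "\<exists>x. dist x z < d \<and>
      f (z + s *\<^sub>R a + s *\<^sub>R b) - f (z + s *\<^sub>R a) - f (z + s *\<^sub>R b) + f z = s\<^sup>2 * second_deriv a b x"
    if ab: "norm a + norm b = norm u + norm v" for a b
    using second_difference_mean_value[OF s, of f z a b] inS[OF _ _ _ _ ab] near[OF _ _ _ _ ab]
      differentiable dir_deriv_differentiable unfolding second_deriv_def by meson
  from this[of u v] this[of v u] obtain x y where xy: "dist x z < d" "dist y z < d"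
    "f (z + s *\<^sub>R u + s *\<^sub>R v) - f (z + s *\<^sub>R u) - f (z + s *\<^sub>R v) + f z = s\<^sup>2 * second_deriv u v x"
    "f (z + s *\<^sub>R v + s *\<^sub>R u) - f (z + s *\<^sub>R v) - f (z + s *\<^sub>R u) + f z = s\<^sup>2 * second_deriv v u y"
    by (metis add.commute)
  have swap: "z + s *\<^sub>R v + s *\<^sub>R u = z + s *\<^sub>R u + s *\<^sub>R v" by (simp add: algebra_simps)
  have "s\<^sup>2 * second_deriv u v x = s\<^sup>2 * second_deriv v u y" using xy(3) xy(4)[unfolded swap] by linarith
  then have "second_deriv u v x = second_deriv v u y" using s by simp
  moreover have "dist x z < d1" "dist y z < d2" using xy(1,2) by (auto simp: d_def)
  ultimately have "dist (second_deriv u v x) (second_deriv u v z) < e"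
    "dist (second_deriv u v x) (second_deriv v u z) < e" using d1(2)[of x] d2(2)[of y] by auto
  then have "dist (second_deriv u v z) (second_deriv v u z) < 2 * e"
    using dist_triangle2[of "second_deriv u v z" "second_deriv v u z" "second_deriv u v x"]
    by (simp add: dist_commute)
  then show False by (simp add: e_def dist_real_def)
qed

lemma taylor_second_order:
  assumes seg: "\<And>\<tau>. 0 \<le> \<tau> \<Longrightarrow> \<tau> \<le> 1 \<Longrightarrow> z + \<tau> *\<^sub>R w \<in> S"
  shows "\<exists>\<theta>. 0 \<le> \<theta> \<and> \<theta> \<le> 1 \<and>
    f (z + w) = f z + dir_deriv f w z + second_deriv w w (z + \<theta> *\<^sub>R w) / 2"
proof -
  define D where "D m \<tau> = (if m = 0 then f (z + \<tau> *\<^sub>R w)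
    else if m = 1 then dir_deriv f w (z + \<tau> *\<^sub>R w) else second_deriv w w (z + \<tau> *\<^sub>R w))" for m :: nat and \<tau>
  have "\<forall>m t. m < 2 \<and> 0 \<le> t \<and> t \<le> 1 \<longrightarrow> DERIV (D m) t :> D (Suc m) t"
  proof (intro allI impI)
    fix m :: nat and t :: real assume a: "m < 2 \<and> 0 \<le> t \<and> t \<le> 1"
    then have "z + t *\<^sub>R w \<in> S" using seg by simp
    then have "((\<lambda>\<tau>. f (z + \<tau> *\<^sub>R w)) has_real_derivative dir_deriv f w (z + t *\<^sub>R w)) (at t)"
      "((\<lambda>\<tau>. dir_deriv f w (z + \<tau> *\<^sub>R w)) has_real_derivative second_deriv w w (z + t *\<^sub>R w)) (at t)"
      unfolding second_deriv_def
      by (auto intro!: dir_deriv_along_line differentiable dir_deriv_differentiable)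
    then show "DERIV (D m) t :> D (Suc m) t"
      using a unfolding D_def[abs_def] by (cases "m = 0") (auto simp: less_2_cases_iff)
  qed
  from Maclaurin[of 1 2 D "D 0", OF _ _ refl this] obtain t where t: "0 < t" "t < 1"
    "D 0 1 = (\<Sum>m<2. D m 0 / fact m * 1 ^ m) + D 2 t / fact 2 * 1 ^ 2"
    by auto
  then have "f (z + w) = f z + dir_deriv f w z + second_deriv w w (z + t *\<^sub>R w) / 2"
    by (simp add: D_def numeral_2_eq_2)
  then show ?thesis using t by (intro exI[of _ t]) auto
qed

text \<open>
Continuity is given for fixed directions only; the finite expansion in a basis makes it joint in the
point and the directions.
\<close>

lemma second_deriv_tendsto:
  assumes z: "z \<in> S" and \<zeta>: "\<zeta> \<longlonglongrightarrow> z" and w: "w \<longlonglongrightarrow> l"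
  shows "(\<lambda>k. second_deriv (w k) (w k) (\<zeta> k)) \<longlonglongrightarrow> second_deriv l l z"
proof -
  have expand: "second_deriv w w x = (\<Sum>(i, j)\<in>Basis \<times> Basis. (w \<bullet> i) * (w \<bullet> j) * second_deriv i j x)"
    if "x \<in> S" for w x
  proof -
    note B = second_deriv_bilinear[OF that]
    have "second_deriv w w x = second_deriv (\<Sum>i\<in>Basis. (w \<bullet> i) *\<^sub>R i) (\<Sum>i\<in>Basis. (w \<bullet> i) *\<^sub>R i) x"
      by (simp add: euclidean_representation)
    also have "\<dots> = (\<Sum>(i, j)\<in>Basis \<times> Basis. second_deriv ((w \<bullet> i) *\<^sub>R i) ((w \<bullet> j) *\<^sub>R j) x)"
      by (rule bilinear_sum[OF B])
    also have "\<dots> = (\<Sum>(i, j)\<in>Basis \<times> Basis. (w \<bullet> i) * (w \<bullet> j) * second_deriv i j x)"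
      by (intro sum.cong) (auto simp: bilinear_lmul[OF B] bilinear_rmul[OF B])
    finally show ?thesis .
  qed
  have "(\<lambda>k. \<Sum>(i, j)\<in>Basis \<times> Basis. (w k \<bullet> i) * (w k \<bullet> j) * second_deriv i j (\<zeta> k))
      \<longlonglongrightarrow> (\<Sum>(i, j)\<in>Basis \<times> Basis. (l \<bullet> i) * (l \<bullet> j) * second_deriv i j z)"
    unfolding split_def
    by (intro tendsto_intros w isCont_tendsto_compose[OF second_deriv_isCont[OF z] \<zeta>])
  moreover have "\<forall>\<^sub>F k in sequentially. \<zeta> k \<in> S" using \<zeta> open_S z by (rule topological_tendstoD)
  then have "\<forall>\<^sub>F k in sequentially. second_deriv (w k) (w k) (\<zeta> k)
      = (\<Sum>(i, j)\<in>Basis \<times> Basis. (w k \<bullet> i) * (w k \<bullet> j) * second_deriv i j (\<zeta> k))"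
    by eventually_elim (rule expand)
  ultimately show ?thesis unfolding expand[OF z] by (simp add: tendsto_cong)
qed

text \<open>
The first-order term is kept at the moving point \<open>z k\<close>: divided by \<open>\<epsilon>\<close> it need not converge, and it is only
controlled later, by the choice of the direction.
\<close>

lemma scaled_difference_tendsto:
  assumes z0: "z0 \<in> S" and z: "z \<longlonglongrightarrow> z0" and \<epsilon>: "\<epsilon> \<longlonglongrightarrow> 0" "\<And>k. \<epsilon> k > (0::real)"
    and w: "w \<longlonglongrightarrow> l"
  shows "(\<lambda>k. (f (z k + \<epsilon> k *\<^sub>R w k) - f (z k)) / (\<epsilon> k)\<^sup>2 - dir_deriv f (w k) (z k) / \<epsilon> k)
    \<longlonglongrightarrow> second_deriv l l z0 / 2"
proof -
  obtain r where r: "r > 0" "ball z0 r \<subseteq> S" using open_S z0 openE by blast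
  have "(\<lambda>k. z k + \<epsilon> k *\<^sub>R w k) \<longlonglongrightarrow> z0 + 0 *\<^sub>R l" by (intro tendsto_intros z \<epsilon> w)
  then have "\<forall>\<^sub>F k in sequentially. z k + \<epsilon> k *\<^sub>R w k \<in> ball z0 r"
    using r by (intro topological_tendstoD) auto
  moreover have "\<forall>\<^sub>F k in sequentially. z k \<in> ball z0 r" using z r by (intro topological_tendstoD) auto
  ultimately have good: "\<forall>\<^sub>F k in sequentially. z k \<in> ball z0 r \<and> z k + \<epsilon> k *\<^sub>R w k \<in> ball z0 r"
    by eventually_elim auto
  have "\<exists>\<theta>. 0 \<le> \<theta> \<and> \<theta> \<le> 1 \<and> (z k \<in> ball z0 r \<and> z k + \<epsilon> k *\<^sub>R w k \<in> ball z0 r \<longrightarrow>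
      f (z k + \<epsilon> k *\<^sub>R w k) = f (z k) + dir_deriv f (\<epsilon> k *\<^sub>R w k) (z k)
        + second_deriv (\<epsilon> k *\<^sub>R w k) (\<epsilon> k *\<^sub>R w k) (z k + \<theta> *\<^sub>R \<epsilon> k *\<^sub>R w k) / 2)" for k
  proof (cases "z k \<in> ball z0 r \<and> z k + \<epsilon> k *\<^sub>R w k \<in> ball z0 r")
    case True
    have "z k + \<tau> *\<^sub>R \<epsilon> k *\<^sub>R w k \<in> S" if "0 \<le> \<tau>" "\<tau> \<le> 1" for \<tau>
    proof -
      have "(1 - \<tau>) *\<^sub>R z k + \<tau> *\<^sub>R (z k + \<epsilon> k *\<^sub>R w k) \<in> ball z0 r"
        using True that by (intro convexD[OF convex_ball]) auto
      then show ?thesis using r by (auto simp: algebra_simps)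
    qed
    from taylor_second_order[OF this] show ?thesis by blast
  qed (auto intro: exI[of _ 0])
  then obtain \<theta> where \<theta>: "\<And>k. 0 \<le> \<theta> k \<and> \<theta> k \<le> 1"
    "\<And>k. z k \<in> ball z0 r \<and> z k + \<epsilon> k *\<^sub>R w k \<in> ball z0 r \<Longrightarrow>
      f (z k + \<epsilon> k *\<^sub>R w k) = f (z k) + dir_deriv f (\<epsilon> k *\<^sub>R w k) (z k)
        + second_deriv (\<epsilon> k *\<^sub>R w k) (\<epsilon> k *\<^sub>R w k) (z k + \<theta> k *\<^sub>R \<epsilon> k *\<^sub>R w k) / 2"
    by metis
  define \<zeta> where "\<zeta> k = z k + \<theta> k *\<^sub>R \<epsilon> k *\<^sub>R w k" for k
  have small: "(\<lambda>k. \<epsilon> k *\<^sub>R w k) \<longlonglongrightarrow> 0" using tendsto_scaleR[OF \<epsilon>(1) w] by simp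
  have "(\<lambda>k. \<theta> k *\<^sub>R \<epsilon> k *\<^sub>R w k) \<longlonglongrightarrow> 0"
    by (rule Lim_null_comparison[OF _ tendsto_norm_zero[OF small]])
      (use \<theta>(1) in \<open>auto intro!: always_eventually mult_left_le_one_le simp: abs_mult mult.assoc\<close>)
  from tendsto_add[OF z this] have \<zeta>: "\<zeta> \<longlonglongrightarrow> z0" by (simp add: \<zeta>_def[abs_def])
  have "\<forall>\<^sub>F k in sequentially. \<zeta> k \<in> S" using \<zeta> open_S z0 by (rule topological_tendstoD)
  with good have "\<forall>\<^sub>F k in sequentially. second_deriv (w k) (w k) (\<zeta> k) / 2
      = (f (z k + \<epsilon> k *\<^sub>R w k) - f (z k)) / (\<epsilon> k)\<^sup>2 - dir_deriv f (w k) (z k) / \<epsilon> k"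
  proof eventually_elim
    case (elim k)
    then have "z k \<in> S" using r by auto
    have "f (z k + \<epsilon> k *\<^sub>R w k) - f (z k)
        = \<epsilon> k * dir_deriv f (w k) (z k) + (\<epsilon> k)\<^sup>2 * second_deriv (w k) (w k) (\<zeta> k) / 2"
      using \<theta>(2)[of k, folded \<zeta>_def] elim linear_scale[OF dir_deriv_linear[OF \<open>z k \<in> S\<close>]]
        bilinear_lmul[OF second_deriv_bilinear, of "\<zeta> k"] bilinear_rmul[OF second_deriv_bilinear, of "\<zeta> k"]
      by (simp add: power2_eq_square)
    then show ?case using \<epsilon>(2)[of k] by (simp add: field_simps power2_eq_square)
  qed
  moreover have "(\<lambda>k. second_deriv (w k) (w k) (\<zeta> k) / 2) \<longlonglongrightarrow> second_deriv l l z0 / 2"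
    by (intro tendsto_intros second_deriv_tendsto z0 \<zeta> w) simp
  ultimately show ?thesis by (rule Lim_transform_eventually[rotated])
qed

end

section \<open>The effect of one round on a test function\<close>

text \<open>
The effect of one round of the game, scaled by \<open>\<epsilon>\<^sup>2\<close>, along sequences approaching \<open>z0\<close>.  The roles are
\<open>G\<close> for the spatial gradient near \<open>z0\<close>, \<open>X\<close> for the spatial Hessian and \<open>c\<close> for the time derivative at
\<open>z0\<close>.  Both the smooth test functions and the quartic penalty satisfy it, and it is stable under
sums and sign changes.
\<close>

definition parabolic_expansion ::
  "((real^'n) \<times> real \<Rightarrow> real) \<Rightarrow> ((real^'n) \<times> real \<Rightarrow> real^'n) \<Rightarrow> real^'n^'n \<Rightarrow> real \<Rightarrow>
    (real^'n) \<times> real \<Rightarrow> bool" where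
  "parabolic_expansion \<phi> G X c z0 \<longleftrightarrow> isCont G z0 \<and>
     (\<forall>z \<epsilon> h l. z \<longlonglongrightarrow> z0 \<longrightarrow> \<epsilon> \<longlonglongrightarrow> 0 \<longrightarrow> (\<forall>k. \<epsilon> k > 0) \<longrightarrow> h \<longlonglongrightarrow> l \<longrightarrow>
       (\<lambda>k. (\<phi> (fst (z k) + (sqrt 2 * \<epsilon> k) *\<^sub>R h k, snd (z k) - (\<epsilon> k)\<^sup>2) - \<phi> (z k)) / (\<epsilon> k)\<^sup>2
          - sqrt 2 * (G (z k) \<bullet> h k) / \<epsilon> k) \<longlonglongrightarrow> l \<bullet> (X *v l) - c)"

lemma parabolic_expansionD:
  assumes "parabolic_expansion \<phi> G X c z0" "z \<longlonglongrightarrow> z0" "\<epsilon> \<longlonglongrightarrow> 0" "\<And>k. \<epsilon> k > 0" "h \<longlonglongrightarrow> l"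
  shows "(\<lambda>k. (\<phi> (fst (z k) + (sqrt 2 * \<epsilon> k) *\<^sub>R h k, snd (z k) - (\<epsilon> k)\<^sup>2) - \<phi> (z k)) / (\<epsilon> k)\<^sup>2
          - sqrt 2 * (G (z k) \<bullet> h k) / \<epsilon> k) \<longlonglongrightarrow> l \<bullet> (X *v l) - c"
  using assms unfolding parabolic_expansion_def by blast

lemma parabolic_expansion_add:
  fixes X Y :: "real^'n^'n"
  assumes "parabolic_expansion \<phi> G X c z0" "parabolic_expansion \<psi> H Y d z0"
  shows "parabolic_expansion (\<lambda>z. \<phi> z + \<psi> z) (\<lambda>z. G z + H z) (X + Y) (c + d) z0"
  unfolding parabolic_expansion_def
proof (intro conjI allI impI)
  show "isCont (\<lambda>z. G z + H z) z0"
    using assms by (intro continuous_intros) (auto simp: parabolic_expansion_def)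
  fix z :: "nat \<Rightarrow> (real^'n) \<times> real" and \<epsilon> :: "nat \<Rightarrow> real" and h :: "nat \<Rightarrow> real^'n" and l
  assume a: "z \<longlonglongrightarrow> z0" "\<epsilon> \<longlonglongrightarrow> 0" "\<forall>k. \<epsilon> k > (0::real)" "h \<longlonglongrightarrow> l"
  have "l \<bullet> (X *v l) - c + (l \<bullet> (Y *v l) - d) = l \<bullet> ((X + Y) *v l) - (c + d)"
    by (simp add: matrix_vector_mult_add_rdistrib inner_add_right)
  with tendsto_add[OF parabolic_expansionD[OF assms(1) a(1,2) _ a(4)] parabolic_expansionD[OF assms(2) a(1,2) _ a(4)]] a(3)
  show "(\<lambda>k. (\<phi> (fst (z k) + (sqrt 2 * \<epsilon> k) *\<^sub>R h k, snd (z k) - (\<epsilon> k)\<^sup>2)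
        + \<psi> (fst (z k) + (sqrt 2 * \<epsilon> k) *\<^sub>R h k, snd (z k) - (\<epsilon> k)\<^sup>2) - (\<phi> (z k) + \<psi> (z k))) / (\<epsilon> k)\<^sup>2
      - sqrt 2 * ((G (z k) + H (z k)) \<bullet> h k) / \<epsilon> k) \<longlonglongrightarrow> l \<bullet> ((X + Y) *v l) - (c + d)"
    by (simp add: diff_divide_distrib add_divide_distrib inner_add_left distrib_left algebra_simps)
qed

lemma parabolic_expansion_uminus:
  fixes X :: "real^'n^'n"
  assumes "parabolic_expansion \<phi> G X c z0"
  shows "parabolic_expansion (\<lambda>z. - \<phi> z) (\<lambda>z. - G z) (- X) (- c) z0"
  unfolding parabolic_expansion_def
proof (intro conjI allI impI)
  show "isCont (\<lambda>z. - G z) z0"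
    using assms by (intro continuous_intros) (auto simp: parabolic_expansion_def)
  fix z :: "nat \<Rightarrow> (real^'n) \<times> real" and \<epsilon> :: "nat \<Rightarrow> real" and h :: "nat \<Rightarrow> real^'n" and l
  assume a: "z \<longlonglongrightarrow> z0" "\<epsilon> \<longlonglongrightarrow> 0" "\<forall>k. \<epsilon> k > (0::real)" "h \<longlonglongrightarrow> l"
  have "(- X) *v l = - (X *v l)"
    using matrix_vector_mult_diff_rdistrib[of 0 X l] by simp
  with tendsto_minus[OF parabolic_expansionD[OF assms a(1,2) _ a(4)]] a(3)
  show "(\<lambda>k. (- \<phi> (fst (z k) + (sqrt 2 * \<epsilon> k) *\<^sub>R h k, snd (z k) - (\<epsilon> k)\<^sup>2) - - \<phi> (z k)) / (\<epsilon> k)\<^sup>2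
      - sqrt 2 * (- G (z k) \<bullet> h k) / \<epsilon> k) \<longlonglongrightarrow> l \<bullet> ((- X) *v l) - (- c)"
    by (simp add: diff_divide_distrib add_divide_distrib algebra_simps)
qed

text \<open>
With \<open>\<rho> = |z - z0|\<^sup>2\<close>, one round replaces \<open>\<rho>\<close> by \<open>\<rho> + \<epsilon> \<alpha> + \<epsilon>\<^sup>2 \<beta>\<close>, where \<open>\<alpha> \<rightarrow> 0\<close> and \<open>\<beta>\<close> is
bounded.  After removal of the first-order term \<open>2 \<rho> \<alpha> / \<epsilon>\<close>, the scaled difference of the squares is
\<open>2 \<rho> \<beta> + (\<alpha> + \<epsilon> \<beta>)\<^sup>2\<close>.
\<close>

lemma parabolic_expansion_quartic:
  fixes z0 :: "(real^'n) \<times> real"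
  shows "parabolic_expansion (\<lambda>z. ((norm (z - z0))\<^sup>2)\<^sup>2)
    (\<lambda>z. (4 * (norm (z - z0))\<^sup>2) *\<^sub>R (fst z - fst z0)) 0 0 z0"
  unfolding parabolic_expansion_def
proof (intro conjI allI impI)
  show "isCont (\<lambda>z. (4 * (norm (z - z0))\<^sup>2) *\<^sub>R (fst z - fst z0)) z0" by (intro continuous_intros)
  fix z :: "nat \<Rightarrow> (real^'n) \<times> real" and \<epsilon> :: "nat \<Rightarrow> real" and h :: "nat \<Rightarrow> real^'n" and l
  assume a: "z \<longlonglongrightarrow> z0" "\<epsilon> \<longlonglongrightarrow> 0" "\<forall>k. \<epsilon> k > (0::real)" "h \<longlonglongrightarrow> l"
  define \<rho> where "\<rho> k = (norm (z k - z0))\<^sup>2" for k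
  define \<alpha> where "\<alpha> k = 2 * sqrt 2 * ((fst (z k) - fst z0) \<bullet> h k)" for k
  define \<beta> where "\<beta> k = 2 * (h k \<bullet> h k) - 2 * (snd (z k) - snd z0) + (\<epsilon> k)\<^sup>2" for k
  have norm_prod: "(norm p)\<^sup>2 = fst p \<bullet> fst p + snd p * snd p" for p :: "(real^'n) \<times> real"
    by (simp add: power2_norm_eq_inner inner_prod_def)
  have expand: "(norm ((fst (z k) + (sqrt 2 * \<epsilon> k) *\<^sub>R h k, snd (z k) - (\<epsilon> k)\<^sup>2) - z0))\<^sup>2
      = \<rho> k + \<epsilon> k * \<alpha> k + (\<epsilon> k)\<^sup>2 * \<beta> k" for k
  proof -
    define y s where "y = fst (z k) - fst z0" and "s = snd (z k) - snd z0"
    have *: "fst (z k) + (sqrt 2 * \<epsilon> k) *\<^sub>R h k - fst z0 = y + (sqrt 2 * \<epsilon> k) *\<^sub>R h k"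
      "snd (z k) - (\<epsilon> k)\<^sup>2 - snd z0 = s - (\<epsilon> k)\<^sup>2" by (auto simp: y_def s_def)
    have "(y + (sqrt 2 * \<epsilon> k) *\<^sub>R h k) \<bullet> (y + (sqrt 2 * \<epsilon> k) *\<^sub>R h k)
        = y \<bullet> y + \<epsilon> k * (2 * sqrt 2 * (y \<bullet> h k)) + 2 * (\<epsilon> k)\<^sup>2 * (h k \<bullet> h k)"
      by (simp add: inner_add_left inner_add_right inner_commute algebra_simps power2_eq_square)
    then show ?thesis
      by (simp add: norm_prod * \<rho>_def \<alpha>_def \<beta>_def y_def[symmetric] s_def[symmetric])
        (simp add: algebra_simps power2_eq_square)
  qed
  have "(\<lambda>k. 2 * \<rho> k * \<beta> k + (\<alpha> k + \<epsilon> k * \<beta> k)\<^sup>2) \<longlonglongrightarrow> 2 * (norm (z0 - z0))\<^sup>2 *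
      (2 * (l \<bullet> l) - 2 * (snd z0 - snd z0) + 0\<^sup>2)
      + (2 * sqrt 2 * ((fst z0 - fst z0) \<bullet> l) + 0 * (2 * (l \<bullet> l) - 2 * (snd z0 - snd z0) + 0\<^sup>2))\<^sup>2"
    unfolding \<rho>_def \<alpha>_def \<beta>_def by (intro tendsto_intros a)
  moreover have "2 * \<rho> k * \<beta> k + (\<alpha> k + \<epsilon> k * \<beta> k)\<^sup>2
      = (((norm ((fst (z k) + (sqrt 2 * \<epsilon> k) *\<^sub>R h k, snd (z k) - (\<epsilon> k)\<^sup>2) - z0))\<^sup>2)\<^sup>2
         - ((norm (z k - z0))\<^sup>2)\<^sup>2) / (\<epsilon> k)\<^sup>2
       - sqrt 2 * (((4 * (norm (z k - z0))\<^sup>2) *\<^sub>R (fst (z k) - fst z0)) \<bullet> h k) / \<epsilon> k" for k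
  proof -
    have e: "\<epsilon> k \<noteq> 0" using a(3) by (metis less_irrefl)
    have "((\<rho> k + \<epsilon> k * \<alpha> k + (\<epsilon> k)\<^sup>2 * \<beta> k)\<^sup>2 - (\<rho> k)\<^sup>2) / (\<epsilon> k)\<^sup>2 - 2 * \<rho> k * \<alpha> k / \<epsilon> k
        = 2 * \<rho> k * \<beta> k + (\<alpha> k + \<epsilon> k * \<beta> k)\<^sup>2"
      using e by (simp add: field_simps power2_eq_square)
    moreover have "sqrt 2 * (((4 * \<rho> k) *\<^sub>R (fst (z k) - fst z0)) \<bullet> h k) = 2 * \<rho> k * \<alpha> k"
      by (simp add: \<alpha>_def)
    ultimately show ?thesis unfolding expand \<rho>_def[symmetric] by metis
  qed
  ultimately show "(\<lambda>k. (((norm ((fst (z k) + (sqrt 2 * \<epsilon> k) *\<^sub>R h k, snd (z k) - (\<epsilon> k)\<^sup>2) - z0))\<^sup>2)\<^sup>2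
         - ((norm (z k - z0))\<^sup>2)\<^sup>2) / (\<epsilon> k)\<^sup>2
       - sqrt 2 * (((4 * (norm (z k - z0))\<^sup>2) *\<^sub>R (fst (z k) - fst z0)) \<bullet> h k) / \<epsilon> k)
       \<longlonglongrightarrow> l \<bullet> (0 *v l) - 0" by simp
qed

text \<open>
One round is a step of size \<open>\<epsilon>\<close> in the space-time direction \<open>(\<surd>2 h, -\<epsilon>)\<close>, so a single Taylor
expansion covers space and time: the time component contributes its first derivative at order
\<open>\<epsilon>\<^sup>2\<close> and drops out of the quadratic term in the limit.
\<close>

lemma smooth_parabolic_expansion:
  fixes \<phi> :: "(real^'n) \<times> real \<Rightarrow> real" and x0 :: "real^'n"
  assumes smooth: "smooth_on (UNIV \<times> {0<..}) \<phi>" and t0: "t0 > 0"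
  defines "X \<equiv> hessian (\<lambda>x. \<phi> (x, t0)) x0"
  shows "\<exists>G. G (x0, t0) = gradient (\<lambda>x. \<phi> (x, t0)) x0 \<and>
      parabolic_expansion \<phi> G X (deriv (\<lambda>t. \<phi> (x0, t)) t0) (x0, t0)"
    and "transpose X = X"
proof -
  let ?S = "UNIV \<times> {0<..} :: ((real^'n) \<times> real) set"
  interpret twice_cont_diff \<phi> ?S
    using smooth by unfold_locales (auto simp: smooth_on_def open_Times simp del: k_times_cont_diff_on.simps)
  define e :: "'n \<Rightarrow> (real^'n) \<times> real" where "e i = (axis i 1, 0)" for i
  define G where "G z = (\<chi> i. dir_deriv \<phi> (e i) z)" for z
  have space: "(h, 0) = (\<Sum>i\<in>UNIV. (h $ i) *\<^sub>R e i)" for h :: "real^'n"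
    using basis_expansion[of h]
    by (simp add: e_def prod_eq_iff fst_sum snd_sum scalar_mult_eq_scaleR)
  have slice: "((\<lambda>y. g (y, s)) has_derivative (\<lambda>h. dir_deriv g (h, 0) (x, s))) (at x)"
    if "g differentiable at (x, s)" for g :: "(real^'n) \<times> real \<Rightarrow> real" and x s
  proof -
    have "((\<lambda>y. (y, s)) has_derivative (\<lambda>h. (h, 0))) (at x)" by (auto intro!: derivative_eq_intros)
    from has_derivative_compose[OF this] show ?thesis
      using that by (simp add: frechet_derivative_works dir_deriv_def)
  qed
  have grad: "gradient (\<lambda>x. \<phi> (x, s)) x = G (x, s)" if "s > 0" for x s
    using that fun_cong[OF frechet_derivative_at[OF slice[OF differentiable, of x s]]]
    by (simp add: gradient_def G_def e_def vec_eq_iff)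
  have X: "X $ i $ j = second_deriv (e j) (e i) (x0, t0)" for i j
    using fun_cong[OF frechet_derivative_at[OF slice[OF dir_deriv_differentiable[of "(x0, t0)" "e j"]]]] t0
    by (simp add: X_def hessian_def grad G_def second_deriv_def e_def)
  show "transpose X = X"
    using second_deriv_commute[of "(x0, t0)"] t0 by (simp add: transpose_def vec_eq_iff X)
  have quad: "second_deriv (h, 0) (h, 0) (x0, t0) = h \<bullet> (X *v h)" for h
  proof -
    have B: "bilinear (\<lambda>v w. second_deriv v w (x0, t0))" using t0 by (intro second_deriv_bilinear) simp
    have "second_deriv (h, 0) (h, 0) (x0, t0)
        = (\<Sum>i\<in>UNIV. \<Sum>j\<in>UNIV. h $ i * (h $ j * second_deriv (e i) (e j) (x0, t0)))"
      unfolding space[of h] bilinear_sum[OF B]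
      by (simp add: sum.cartesian_product split_def bilinear_lmul[OF B] bilinear_rmul[OF B] mult.left_commute)
    also have "\<dots> = h \<bullet> (X *v h)"
      using second_deriv_commute[of "(x0, t0)"] t0
      by (simp add: inner_vec_def matrix_vector_mult_def sum_distrib_left X mult_ac)
    finally show ?thesis .
  qed
  have D: "dir_deriv \<phi> (h, \<tau>) z = G z \<bullet> h + \<tau> * dir_deriv \<phi> (0, 1) z" if "z \<in> ?S" for h \<tau> z
  proof -
    note L = dir_deriv_linear[OF that]
    have "(h, \<tau>) = (h, 0) + \<tau> *\<^sub>R (0, 1)" by simp
    then have "dir_deriv \<phi> (h, \<tau>) z = dir_deriv \<phi> (h, 0) z + \<tau> * dir_deriv \<phi> (0, 1) z"
      using linear_add[OF L, of "(h, 0)" "\<tau> *\<^sub>R (0, 1)"] linear_scale[OF L, of \<tau> "(0, 1)"] by simp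
    also have "dir_deriv \<phi> (h, 0) z = G z \<bullet> h"
      unfolding space by (simp add: linear_sum[OF L] linear_scale[OF L] G_def inner_vec_def mult.commute)
    finally show ?thesis .
  qed
  have c: "deriv (\<lambda>t. \<phi> (x0, t)) t0 = dir_deriv \<phi> (0, 1) (x0, t0)"
  proof -
    have "((\<lambda>\<tau>. \<phi> ((x0, 0) + \<tau> *\<^sub>R (0, 1))) has_real_derivative
        dir_deriv \<phi> (0, 1) ((x0, 0) + t0 *\<^sub>R (0, 1))) (at t0)"
      using t0 by (intro dir_deriv_along_line differentiable) simp
    then show ?thesis by (simp add: DERIV_imp_deriv)
  qed
  have "parabolic_expansion \<phi> G X (deriv (\<lambda>t. \<phi> (x0, t)) t0) (x0, t0)"
    unfolding parabolic_expansion_def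
  proof (intro conjI allI impI)
    show "isCont G (x0, t0)"
      using dir_deriv_isCont[of "(x0, t0)"] t0
      unfolding G_def[abs_def] isCont_def by (intro tendsto_vec_lambda) auto
    fix z :: "nat \<Rightarrow> (real^'n) \<times> real" and \<epsilon> :: "nat \<Rightarrow> real" and h :: "nat \<Rightarrow> real^'n" and l
  assume a: "z \<longlonglongrightarrow> (x0, t0)" "\<epsilon> \<longlonglongrightarrow> 0" "\<forall>k. \<epsilon> k > (0::real)" "h \<longlonglongrightarrow> l"
    define w where "w k = (sqrt 2 *\<^sub>R h k, - \<epsilon> k)" for k
    have "w \<longlonglongrightarrow> (sqrt 2 *\<^sub>R l, - 0)" unfolding w_def by (intro tendsto_intros a)
    then have "(\<lambda>k. (\<phi> (z k + \<epsilon> k *\<^sub>R w k) - \<phi> (z k)) / (\<epsilon> k)\<^sup>2 - dir_deriv \<phi> (w k) (z k) / \<epsilon> k)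
        \<longlonglongrightarrow> second_deriv (sqrt 2 *\<^sub>R l, - 0) (sqrt 2 *\<^sub>R l, - 0) (x0, t0) / 2"
      using a t0 by (intro scaled_difference_tendsto) auto
    moreover have "(\<lambda>k. dir_deriv \<phi> (0, 1) (z k)) \<longlonglongrightarrow> dir_deriv \<phi> (0, 1) (x0, t0)"
      using t0 by (intro isCont_tendsto_compose[OF dir_deriv_isCont] a) simp
    ultimately have lim: "(\<lambda>k. (\<phi> (z k + \<epsilon> k *\<^sub>R w k) - \<phi> (z k)) / (\<epsilon> k)\<^sup>2
          - dir_deriv \<phi> (w k) (z k) / \<epsilon> k - dir_deriv \<phi> (0, 1) (z k))
        \<longlonglongrightarrow> second_deriv (sqrt 2 *\<^sub>R l, - 0) (sqrt 2 *\<^sub>R l, - 0) (x0, t0) / 2 - dir_deriv \<phi> (0, 1) (x0, t0)"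
      by (rule tendsto_diff)
    have val: "second_deriv (sqrt 2 *\<^sub>R l, - 0) (sqrt 2 *\<^sub>R l, - 0) (x0, t0) / 2 = l \<bullet> (X *v l)"
      by (simp add: quad matrix_vector_mult_scaleR)
    have "\<forall>\<^sub>F k in sequentially. z k \<in> ?S"
      by (rule topological_tendstoD[OF a(1) open_S]) (use t0 in simp)
    then have eq: "\<forall>\<^sub>F k in sequentially.
        (\<phi> (z k + \<epsilon> k *\<^sub>R w k) - \<phi> (z k)) / (\<epsilon> k)\<^sup>2 - dir_deriv \<phi> (w k) (z k) / \<epsilon> k
          - dir_deriv \<phi> (0, 1) (z k)
        = (\<phi> (fst (z k) + (sqrt 2 * \<epsilon> k) *\<^sub>R h k, snd (z k) - (\<epsilon> k)\<^sup>2) - \<phi> (z k)) / (\<epsilon> k)\<^sup>2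
          - sqrt 2 * (G (z k) \<bullet> h k) / \<epsilon> k"
    proof eventually_elim
      case (elim k)
      have "z k + \<epsilon> k *\<^sub>R w k = (fst (z k) + (sqrt 2 * \<epsilon> k) *\<^sub>R h k, snd (z k) - (\<epsilon> k)\<^sup>2)"
        by (simp add: w_def prod_eq_iff power2_eq_square)
      moreover have "dir_deriv \<phi> (w k) (z k) / \<epsilon> k
          = sqrt 2 * (G (z k) \<bullet> h k) / \<epsilon> k - dir_deriv \<phi> (0, 1) (z k)"
        using D[OF elim, of "sqrt 2 *\<^sub>R h k" "- \<epsilon> k"] a(3)[rule_format, of k]
        by (simp add: w_def diff_divide_distrib)
      ultimately show ?case by simp
    qed
    show "(\<lambda>k. (\<phi> (fst (z k) + (sqrt 2 * \<epsilon> k) *\<^sub>R h k, snd (z k) - (\<epsilon> k)\<^sup>2) - \<phi> (z k)) / (\<epsilon> k)\<^sup>2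
          - sqrt 2 * (G (z k) \<bullet> h k) / \<epsilon> k) \<longlonglongrightarrow> l \<bullet> (X *v l) - deriv (\<lambda>t. \<phi> (x0, t)) t0"
      using Lim_transform_eventually[OF lim eq] unfolding c val .
  qed
  then show "\<exists>G. G (x0, t0) = gradient (\<lambda>x. \<phi> (x, t0)) x0 \<and>
      parabolic_expansion \<phi> G X (deriv (\<lambda>t. \<phi> (x0, t)) t0) (x0, t0)"
    using grad[OF t0] by metis
qed

section \<open>Half-relaxed limits and sequences\<close>

lemma compact_convergent_subsequence:
  fixes f :: "nat \<Rightarrow> 'a::metric_space"
  assumes "compact K" "\<And>k. f k \<in> K"
  obtains l s where "l \<in> K" "strict_mono (s :: nat \<Rightarrow> nat)" "(f \<circ> s) \<longlonglongrightarrow> l"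
  using assms(1)[unfolded compact_def, rule_format, of f] assms(2) by blast

lemma Limsup_ge_along_sequence:
  fixes g :: "'a \<Rightarrow> ereal"
  assumes "filterlim q F sequentially" "(\<lambda>k. g (q k)) \<longlonglongrightarrow> l"
  shows "l \<le> Limsup F g"
proof (rule ccontr)
  assume "\<not> l \<le> Limsup F g"
  then obtain y where y: "Limsup F g < y" "y < l" using dense by (metis not_le)
  have "\<forall>\<^sub>F k in sequentially. g (q k) < y"
    using Limsup_lessD[OF y(1)] assms(1) by (rule eventually_compose_filterlim)
  moreover have "\<forall>\<^sub>F k in sequentially. y < g (q k)" using assms(2) y(2) by (rule order_tendstoD)
  ultimately have "\<forall>\<^sub>F k in sequentially. False" by eventually_elim simp
  then show False by simp
qed

text \<open>
The filter \<open>nhds z\<close> contains the point \<open>z\<close>, so an upper limit over \<open>nhds z\<close> is already upper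
semicontinuous in \<open>z\<close>, and taking its envelope changes nothing.
\<close>

lemma usc_envelope_Limsup:
  fixes g :: "'a::topological_space \<times> 'b \<Rightarrow> ereal"
  assumes "z \<in> D"
  shows "usc_envelope D (\<lambda>z. Limsup (nhds z \<times>\<^sub>F G) g) z = Limsup (nhds z \<times>\<^sub>F G) g"
    (is "usc_envelope D ?f z = _")
proof (rule antisym)
  have "\<forall>\<^sub>F z' in inf (nhds z) (principal D). ?f z' < y" if "?f z < y" for y
  proof -
    obtain y' where y': "?f z < y'" "y' < y" using \<open>?f z < y\<close> dense by blast
    have "\<forall>\<^sub>F p in nhds z \<times>\<^sub>F G. g p < y'" using y'(1) by (rule Limsup_lessD)
    then obtain P Q where PQ: "eventually P (nhds z)" "eventually Q G"
      "\<And>x e. P x \<Longrightarrow> Q e \<Longrightarrow> g (x, e) < y'"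
      by (auto simp: eventually_prod_filter)
    have "\<forall>\<^sub>F z' in nhds z. eventually P (nhds z')" using PQ(1) by (simp add: eventually_eventually)
    then have "\<forall>\<^sub>F z' in nhds z. ?f z' < y"
    proof eventually_elim
      case (elim z')
      have "\<forall>\<^sub>F p in nhds z' \<times>\<^sub>F G. g p \<le> y'"
        unfolding eventually_prod_filter using elim PQ(2,3) by (meson less_imp_le)
      then have "?f z' \<le> y'" by (rule Limsup_bounded)
      then show ?case using y'(2) by simp
    qed
    then show ?thesis by (rule filter_leD[OF inf_le1])
  qed
  then show "usc_envelope D ?f z \<le> ?f z"
    unfolding usc_envelope_def Limsup_le_iff[of "inf (nhds z) (principal D)"] by blast
  have "P z" if "eventually P (inf (nhds z) (principal D))" for P
    using that assms eventually_nhds_x_imp_x by (fastforce simp: eventually_inf_principal)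
  then show "?f z \<le> usc_envelope D ?f z"
    unfolding usc_envelope_def by (intro Limsup_greatest SUP_upper) simp
qed

lemma lsc_envelope_uminus: "lsc_envelope D (\<lambda>z. - f z) z = - usc_envelope D f z"
  unfolding lsc_envelope_def usc_envelope_def
  using ereal_Limsup_uminus[of _ "\<lambda>z. - f z"] by simp

text \<open>
The sequential description of \<open>U z = limsup w \<epsilon> y\<close> for \<open>y \<rightarrow> z\<close>, \<open>\<epsilon> \<down> 0\<close>: an upper
bound for all limits along sequences that is itself such a limit.
\<close>

definition attained_upper_limit :: "(real \<Rightarrow> 'a::metric_space \<Rightarrow> real) \<Rightarrow> ('a \<Rightarrow> real) \<Rightarrow> bool" where
  "attained_upper_limit w U \<longleftrightarrow>
     (\<forall>z z' \<epsilon> l. z \<longlonglongrightarrow> z' \<and> \<epsilon> \<longlonglongrightarrow> 0 \<and> (\<forall>k::nat. \<epsilon> k > 0) \<and> (\<lambda>k. w (\<epsilon> k) (z k)) \<longlonglongrightarrow> l \<longrightarrow> l \<le> U z') \<and>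
     (\<forall>z'. \<exists>z \<epsilon>. z \<longlonglongrightarrow> z' \<and> \<epsilon> \<longlonglongrightarrow> 0 \<and> (\<forall>k::nat. \<epsilon> k > 0) \<and> (\<lambda>k. w (\<epsilon> k) (z k)) \<longlonglongrightarrow> U z')"

lemma attained_upper_limitI:
  fixes w :: "real \<Rightarrow> 'a::metric_space \<Rightarrow> real"
  assumes bound: "\<And>\<epsilon> z. \<epsilon> > 0 \<Longrightarrow> \<bar>w \<epsilon> z\<bar> \<le> B"
    and U: "\<And>z. Limsup (nhds z \<times>\<^sub>F at_right 0) (\<lambda>(y, \<epsilon>). ereal (w \<epsilon> y)) = ereal (U z)"
  shows "attained_upper_limit w U"
proof -
  have upper: "l \<le> U z'" if "z \<longlonglongrightarrow> z'" "\<epsilon> \<longlonglongrightarrow> 0" "\<And>k::nat. \<epsilon> k > 0" "(\<lambda>k. w (\<epsilon> k) (z k)) \<longlonglongrightarrow> l"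
    for z z' \<epsilon> l
  proof -
    have "filterlim \<epsilon> (at_right 0) sequentially" 
      using that(2,3) by (intro tendsto_imp_filterlim_at_right always_eventually) auto
    then have "filterlim (\<lambda>k. (z k, \<epsilon> k)) (nhds z' \<times>\<^sub>F at_right 0) sequentially"
      using that(1) by (intro filterlim_Pair)
    then have "ereal l \<le> Limsup (nhds z' \<times>\<^sub>F at_right 0) (\<lambda>(y, \<epsilon>). ereal (w \<epsilon> y))"
      by (rule Limsup_ge_along_sequence) (use that(4) in simp)
    then show ?thesis by (simp add: U)
  qed
  have "\<exists>z \<epsilon>. z \<longlonglongrightarrow> z' \<and> \<epsilon> \<longlonglongrightarrow> 0 \<and> (\<forall>k::nat. \<epsilon> k > 0) \<and> (\<lambda>k. w (\<epsilon> k) (z k)) \<longlonglongrightarrow> U z'" for z'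
  proof -
    have "\<exists>z \<epsilon>. dist z z' < inverse (real (Suc k)) \<and> 0 < \<epsilon> \<and> \<epsilon> < inverse (real (Suc k)) \<and>
        U z' - inverse (real (Suc k)) < w \<epsilon> z" for k
    proof (rule ccontr)
      define d where "d = inverse (real (Suc k))"
      have d: "d > 0" by (simp add: d_def)
      assume "\<not> ?thesis"
      then have no: "w \<epsilon> z \<le> U z' - d" if "dist z z' < d" "0 < \<epsilon>" "\<epsilon> < d" for z \<epsilon>
        using that unfolding d_def by (meson not_le)
      have "\<forall>\<^sub>F z in nhds z'. dist z z' < d" 
        using d unfolding eventually_nhds_metric by blast
      moreover have "\<forall>\<^sub>F \<epsilon> in at_right 0. \<epsilon> \<in> {0<..<d}" using eventually_at_right_real[OF d] .
      ultimately have "\<forall>\<^sub>F p in nhds z' \<times>\<^sub>F at_right 0. (case p of (y, \<epsilon>) \<Rightarrow> ereal (w \<epsilon> y)) \<le> ereal (U z' - d)"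
        unfolding eventually_prod_filter
        by (intro exI[of _ "\<lambda>z. dist z z' < d"] exI[of _ "\<lambda>\<epsilon>. \<epsilon> \<in> {0<..<d}"]) (use no in auto)
      then have "ereal (U z') \<le> ereal (U z' - d)" unfolding U[symmetric] by (rule Limsup_bounded)
      then show False using d by simp
    qed
    then obtain z \<epsilon> where z: "\<And>k. dist (z k) z' < inverse (real (Suc k))"
      and \<epsilon>: "\<And>k. 0 < \<epsilon> k" "\<And>k. \<epsilon> k < inverse (real (Suc k))"
      and w: "\<And>k. U z' - inverse (real (Suc k)) < w (\<epsilon> k) (z k)" by metis
    have zlim: "z \<longlonglongrightarrow> z'"
      by (rule metric_tendsto_imp_tendsto[OF LIMSEQ_inverse_real_of_nat])
        (use z in \<open>simp add: less_imp_le\<close>)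
    have \<epsilon>lim: "\<epsilon> \<longlonglongrightarrow> 0"
      by (rule tendsto_sandwich[OF _ _ tendsto_const LIMSEQ_inverse_real_of_nat])
        (use \<epsilon> in \<open>simp_all add: less_imp_le\<close>)
    have "(\<lambda>k. w (\<epsilon> k) (z k)) k \<in> cball 0 B" for k using bound[OF \<epsilon>(1)] by simp
    then obtain l r where r: "strict_mono r" "((\<lambda>k. w (\<epsilon> k) (z k)) \<circ> r) \<longlonglongrightarrow> l"
      by (rule compact_convergent_subsequence[OF compact_cball])
    have lims: "(z \<circ> r) \<longlonglongrightarrow> z'" "(\<epsilon> \<circ> r) \<longlonglongrightarrow> 0" "\<And>k. (\<epsilon> \<circ> r) k > 0"
      using LIMSEQ_subseq_LIMSEQ[OF zlim r(1)] LIMSEQ_subseq_LIMSEQ[OF \<epsilon>lim r(1)] \<epsilon>(1)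
      by (simp_all add: o_def)
    have "l \<le> U z'" using upper[OF lims, of l] r(2) by (simp add: o_def)
    moreover have "(\<lambda>k. U z' - inverse (real (Suc (r k)))) \<longlonglongrightarrow> U z' - 0"
      using LIMSEQ_subseq_LIMSEQ[OF LIMSEQ_inverse_real_of_nat r(1)]
      by (intro tendsto_diff tendsto_const) (simp add: o_def)
    then have "U z' - 0 \<le> l"
    proof (rule LIMSEQ_le[OF _ r(2)])
      show "\<exists>N. \<forall>k\<ge>N. U z' - inverse (real (Suc (r k))) \<le> ((\<lambda>k. w (\<epsilon> k) (z k)) \<circ> r) k"
        unfolding o_def using w less_imp_le by blast
    qed
    ultimately have "(\<lambda>k. w ((\<epsilon> \<circ> r) k) ((z \<circ> r) k)) \<longlonglongrightarrow> U z'" using r(2) by (simp add: o_def)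
    then show ?thesis using lims by blast
  qed
  then show ?thesis unfolding attained_upper_limit_def using upper by blast
qed

text \<open>
The points \<open>z k\<close> maximize \<open>w (\<epsilon> k) - \<psi>\<close> on the ball up to \<open>\<epsilon>\<^sup>3\<close>; exact maximizers need not exist,
since \<open>w \<epsilon>\<close> is not assumed semicontinuous.  A limit point \<open>z'\<close> of them is at least as good for
\<open>U - \<psi>\<close> as \<open>z0\<close>, by comparison with a sequence that realizes \<open>U z0\<close>; strictness then gives
\<open>z' = z0\<close> and also the convergence of the values.
\<close>

lemma penalized_maximizers:
  fixes w :: "real \<Rightarrow> 'a::euclidean_space \<Rightarrow> real"
  assumes bound: "\<And>\<epsilon> z. \<epsilon> > 0 \<Longrightarrow> \<bar>w \<epsilon> z\<bar> \<le> B"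
    and U: "attained_upper_limit w U"
    and r: "r > 0" and cont: "continuous_on (cball z0 r) \<psi>"
    and strict: "\<And>z. z \<in> cball z0 r \<Longrightarrow> z \<noteq> z0 \<Longrightarrow> U z - \<psi> z < U z0 - \<psi> z0"
  obtains z \<epsilon> where "z \<longlonglongrightarrow> z0" "\<epsilon> \<longlonglongrightarrow> 0" "\<And>k::nat. \<epsilon> k > 0" "(\<lambda>k. w (\<epsilon> k) (z k)) \<longlonglongrightarrow> U z0"
    "\<And>k y. y \<in> cball z0 r \<Longrightarrow> w (\<epsilon> k) y - \<psi> y \<le> w (\<epsilon> k) (z k) - \<psi> (z k) + (\<epsilon> k) ^ 3"
proof -
  obtain y' \<epsilon>' where y': "y' \<longlonglongrightarrow> z0" "\<epsilon>' \<longlonglongrightarrow> 0" "\<And>k::nat. \<epsilon>' k > 0" "(\<lambda>k. w (\<epsilon>' k) (y' k)) \<longlonglongrightarrow> U z0"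
    using U unfolding attained_upper_limit_def by blast
  have "\<forall>\<^sub>F k in sequentially. y' k \<in> ball z0 r"
    using y'(1) r by (intro topological_tendstoD) auto
  then obtain N where N: "\<And>k. k \<ge> N \<Longrightarrow> y' k \<in> cball z0 r"
    unfolding eventually_sequentially by (meson ball_subset_cball subsetD)
  define y where "y k = y' (k + N)" for k
  define e where "e k = \<epsilon>' (k + N)" for k
  have y: "y \<longlonglongrightarrow> z0" "\<And>k. y k \<in> cball z0 r" and e: "e \<longlonglongrightarrow> 0" "\<And>k. e k > 0"
    and wy: "(\<lambda>k. w (e k) (y k)) \<longlonglongrightarrow> U z0"
    using N y'(3) LIMSEQ_ignore_initial_segment[OF y'(1), of N] LIMSEQ_ignore_initial_segment[OF y'(2), of N]
      LIMSEQ_ignore_initial_segment[OF y'(4), of N]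
    unfolding y_def[abs_def] e_def[abs_def] by auto
  have cball: "compact (cball z0 r)" by simp
  have "\<exists>z\<in>cball z0 r. \<forall>y\<in>cball z0 r. w (e k) y - \<psi> y \<le> w (e k) z - \<psi> z + (e k) ^ 3" for k
  proof -
    have "bounded (\<psi> ` cball z0 r)" using compact_continuous_image[OF cont cball] compact_imp_bounded by blast
    then obtain C where C: "\<And>y. y \<in> cball z0 r \<Longrightarrow> \<bar>\<psi> y\<bar> \<le> C" unfolding bounded_iff by fastforce
    let ?V = "(\<lambda>y. w (e k) y - \<psi> y) ` cball z0 r"
    have bdd: "bdd_above ?V" using bound[OF e(2)[of k]] C by (intro bdd_aboveI2[where M="B + C"]) (smt (verit))
    have ne: "?V \<noteq> {}" using r by auto
    have "Sup ?V - (e k) ^ 3 < Sup ?V" using e(2)[of k] by simp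
    from less_cSupD[OF ne this] obtain z where z: "z \<in> cball z0 r" "Sup ?V - (e k) ^ 3 < w (e k) z - \<psi> z" by auto
    have "w (e k) y - \<psi> y \<le> Sup ?V" if "y \<in> cball z0 r" for y
      using bdd that by (intro cSup_upper) auto
    then show ?thesis using z by (intro bexI[OF _ z(1)]) force
  qed
  then obtain z where z: "\<And>k. z k \<in> cball z0 r"
    "\<And>k y. y \<in> cball z0 r \<Longrightarrow> w (e k) y - \<psi> y \<le> w (e k) (z k) - \<psi> (z k) + (e k) ^ 3" by metis
  have "compact (cball z0 r \<times> cball (0::real) B)" by (intro compact_Times) auto
  moreover have "(z k, w (e k) (z k)) \<in> cball z0 r \<times> cball 0 B" for k using z(1) bound[OF e(2)] by simp
  ultimately obtain q s where q: "q \<in> cball z0 r \<times> cball 0 B" "strict_mono s"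
    "((\<lambda>k. (z k, w (e k) (z k))) \<circ> s) \<longlonglongrightarrow> q"
    by (rule compact_convergent_subsequence)
  define z' l where "z' = fst q" and "l = snd q"
  have z': "z' \<in> cball z0 r" using q(1) by (auto simp: z'_def)
  have lims: "(z \<circ> s) \<longlonglongrightarrow> z'" "(\<lambda>k. w ((e \<circ> s) k) ((z \<circ> s) k)) \<longlonglongrightarrow> l"
    using tendsto_fst[OF q(3)] tendsto_snd[OF q(3)] by (auto simp: z'_def l_def o_def)
  have es: "(e \<circ> s) \<longlonglongrightarrow> 0" "\<And>k. (e \<circ> s) k > 0"
    using LIMSEQ_subseq_LIMSEQ[OF e(1) q(2)] e(2) by auto
  have l: "l \<le> U z'" using U lims es unfolding attained_upper_limit_def by blast
  have "(\<lambda>k. w (e (s k)) (y (s k)) - \<psi> (y (s k))) \<longlonglongrightarrow> U z0 - \<psi> z0"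
  proof (intro tendsto_diff)
    show "(\<lambda>k. w (e (s k)) (y (s k))) \<longlonglongrightarrow> U z0" using LIMSEQ_subseq_LIMSEQ[OF wy q(2)] by (simp add: o_def)
    show "(\<lambda>k. \<psi> (y (s k))) \<longlonglongrightarrow> \<psi> z0"
      using LIMSEQ_subseq_LIMSEQ[OF y(1) q(2)] y(2) r
      by (intro continuous_on_tendsto_compose[OF cont]) (auto simp: o_def)
  qed
  moreover have "(\<lambda>k. w (e (s k)) (z (s k)) - \<psi> (z (s k)) + (e (s k)) ^ 3) \<longlonglongrightarrow> l - \<psi> z' + 0 ^ 3"
    using lims es(1) z(1)
    by (intro tendsto_intros continuous_on_tendsto_compose[OF cont _ z']) (auto simp: o_def)
  ultimately have le: "U z0 - \<psi> z0 \<le> l - \<psi> z' + 0 ^ 3"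
    using z(2)[OF y(2)] by (intro LIMSEQ_le) auto
  have "z' = z0" using strict[OF z'] le l by fastforce
  then have "l = U z0" using le l by simp
  show thesis
  proof (rule that[of "z \<circ> s" "e \<circ> s"])
    show "(z \<circ> s) \<longlonglongrightarrow> z0" "(\<lambda>k. w ((e \<circ> s) k) ((z \<circ> s) k)) \<longlonglongrightarrow> U z0"
      using lims \<open>z' = z0\<close> \<open>l = U z0\<close> by auto
  qed (use es z(2) in auto)
qed

lemma convergent_subsequence_finite_family:
  fixes f :: "nat \<Rightarrow> 'i \<Rightarrow> 'a::metric_space"
  assumes "finite J" "compact K" "\<And>k j. j \<in> J \<Longrightarrow> f k j \<in> K"
  shows "\<exists>r l. strict_mono r \<and> (\<forall>j\<in>J. (\<lambda>k. f (r k) j) \<longlonglongrightarrow> l j)"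
  using assms(1,3)
proof (induction J)
  case empty
  then show ?case by (auto intro!: exI[of _ id] strict_mono_id)
next
  case (insert i J)
  then obtain r l where r: "strict_mono r" "\<And>j. j \<in> J \<Longrightarrow> (\<lambda>k. f (r k) j) \<longlonglongrightarrow> l j" by fastforce
  have "f (r k) i \<in> K" for k using insert.prems by simp
  then obtain a s where s: "strict_mono s" "((\<lambda>k. f (r k) i) \<circ> s) \<longlonglongrightarrow> a"
    by (rule compact_convergent_subsequence[OF assms(2)])
  have "(\<lambda>k. f ((r \<circ> s) k) j) \<longlonglongrightarrow> (l(i := a)) j" if "j \<in> insert i J" for j
    using that s(2) LIMSEQ_subseq_LIMSEQ[OF r(2) s(1), of j] insert.hyps by (auto simp: o_def)
  then show ?case using strict_mono_o[OF r(1) s(1)] by blast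
qed

lemma orthonormal_tuples_limit:
  fixes v :: "nat \<Rightarrow> nat \<Rightarrow> real^'n"
  assumes v: "\<And>k. v k \<in> orthonormal_tuples"
    and lim: "\<And>j. j \<in> {1..<CARD('n)} \<Longrightarrow> (\<lambda>k. v k j) \<longlonglongrightarrow> l j"
  shows "restrict l {1..<CARD('n)} \<in> orthonormal_tuples"
proof -
  have "norm (l j) = 1" if "j \<in> {1..<CARD('n)}" for j
  proof -
    have "(\<lambda>k. norm (v k j)) \<longlonglongrightarrow> norm (l j)" using lim[OF that] by (rule tendsto_norm)
    moreover have "norm (v k j) = 1" for k using v[of k] that by (auto simp: orthonormal_tuples_def)
    ultimately show ?thesis by (simp add: LIMSEQ_const_iff)
  qed
  moreover have "l i \<bullet> l j = 0" if "i \<in> {1..<CARD('n)}" "j \<in> {1..<CARD('n)}" "i \<noteq> j" for i j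
  proof -
    have "(\<lambda>k. v k i \<bullet> v k j) \<longlonglongrightarrow> l i \<bullet> l j" using lim that by (intro tendsto_inner)
    moreover have "v k i \<bullet> v k j = 0" for k
      using v[of k] that by (auto simp: orthonormal_tuples_def pairwise_def orthogonal_def)
    ultimately show ?thesis by (simp add: LIMSEQ_const_iff)
  qed
  ultimately show ?thesis by (auto simp: orthonormal_tuples_def pairwise_def orthogonal_def)
qed

section \<open>Optimality conditions at the approximate maximizers\<close>

lemma matrix_form_bilinear:
  fixes X :: "real^'n^'n"
  shows "bilinear (\<lambda>x y. x \<bullet> (X *v y))"
  unfolding bilinear_def
  by (intro conjI allI linearI)
    (auto simp: inner_add_left inner_add_right matrix_vector_right_distrib matrix_vector_mult_scaleR)

lemma matrix_form_symmetric:
  fixes X :: "real^'n^'n"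
  assumes "transpose X = X"
  shows "x \<bullet> (X *v y) = y \<bullet> (X *v x)"
proof -
  have "x \<bullet> (X *v y) = (transpose X *v x) \<bullet> y"
    by (simp add: dot_lmul_matrix transpose_matrix_vector)
  then show ?thesis using assms by (simp add: inner_commute)
qed

abbreviation round_step :: "(real^'n) \<times> real \<Rightarrow> real \<Rightarrow> real^'n \<Rightarrow> (real^'n) \<times> real" where
  "round_step z \<epsilon> h \<equiv> (fst z + (sqrt 2 * \<epsilon>) *\<^sub>R h, snd z - \<epsilon>\<^sup>2)"

lemma round_step_tendsto:
  assumes "z \<longlonglongrightarrow> z0" "\<epsilon> \<longlonglongrightarrow> 0" "h \<longlonglongrightarrow> l"
  shows "(\<lambda>k. round_step (z k) (\<epsilon> k) (h k)) \<longlonglongrightarrow> z0"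
proof -
  have "(\<lambda>k. round_step (z k) (\<epsilon> k) (h k)) \<longlonglongrightarrow> round_step z0 0 l" by (intro tendsto_intros assms)
  then show ?thesis by simp
qed

lemma displacement_tendsto:
  fixes v :: "nat \<Rightarrow> nat \<Rightarrow> real^'n"
  assumes "\<And>j. j \<in> {1..<CARD('n)} \<Longrightarrow> (\<lambda>k. v k j) \<longlonglongrightarrow> l j"
    and "\<And>j. j \<in> {1..<CARD('n)} \<Longrightarrow> (\<lambda>k. b k j) \<longlonglongrightarrow> \<beta> j"
  shows "(\<lambda>k. displacement (v k) (b k)) \<longlonglongrightarrow> displacement (restrict l {1..<CARD('n)}) \<beta>"
proof -
  have "(\<lambda>k. displacement (v k) (b k)) \<longlonglongrightarrow> (\<Sum>j\<in>{1..<CARD('n)}. \<beta> j *\<^sub>R l j)"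
    unfolding displacement_def using assms by (intro tendsto_sum tendsto_scaleR)
  then show ?thesis by (simp add: displacement_def)
qed

text \<open>
If a round from \<open>z k\<close> decreases \<open>\<psi>\<close> by at most \<open>O(\<epsilon>\<^sup>3)\<close>, then the expansion has a lower bound at both
orders.  The second-order bound still carries the first-order term, which is
divided by \<open>\<epsilon>\<close> and may be large; it has to be cancelled by the caller.
\<close>

lemma almost_increasing_expansion:
  fixes \<psi> :: "(real^'n) \<times> real \<Rightarrow> real"
  assumes exp: "parabolic_expansion \<psi> G X c z0" and z: "z \<longlonglongrightarrow> z0" and \<epsilon>: "\<epsilon> \<longlonglongrightarrow> 0" "\<And>k. \<epsilon> k > 0"
    and h: "h \<longlonglongrightarrow> l"
    and incr: "\<forall>\<^sub>F k in sequentially. \<psi> (z k) \<le> \<psi> (round_step (z k) (\<epsilon> k) (h k)) + C * (\<epsilon> k) ^ 3"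
  obtains Q where "Q \<longlonglongrightarrow> l \<bullet> (X *v l) - c"
    "\<forall>\<^sub>F k in sequentially. - C * \<epsilon> k \<le> Q k + sqrt 2 * (G (z k) \<bullet> h k) / \<epsilon> k"
    "0 \<le> G z0 \<bullet> l"
proof -
  define Q where "Q k = (\<psi> (round_step (z k) (\<epsilon> k) (h k)) - \<psi> (z k)) / (\<epsilon> k)\<^sup>2
    - sqrt 2 * (G (z k) \<bullet> h k) / \<epsilon> k" for k
  have Q: "Q \<longlonglongrightarrow> l \<bullet> (X *v l) - c"
    unfolding Q_def using exp z \<epsilon> h by (rule parabolic_expansionD)
  have bound: "\<forall>\<^sub>F k in sequentially. - C * \<epsilon> k \<le> Q k + sqrt 2 * (G (z k) \<bullet> h k) / \<epsilon> k"
    using incr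
  proof eventually_elim
    case (elim k)
    have "- C * \<epsilon> k = - C * (\<epsilon> k) ^ 3 / (\<epsilon> k)\<^sup>2"
      using \<epsilon>(2)[of k] by (simp add: power2_eq_square power3_eq_cube)
    also have "\<dots> \<le> (\<psi> (round_step (z k) (\<epsilon> k) (h k)) - \<psi> (z k)) / (\<epsilon> k)\<^sup>2"
      using elim by (intro divide_right_mono) auto
    finally show ?case by (simp add: Q_def)
  qed
  then have "\<forall>\<^sub>F k in sequentially. - C * (\<epsilon> k)\<^sup>2 \<le> \<epsilon> k * Q k + sqrt 2 * (G (z k) \<bullet> h k)"
  proof eventually_elim
    case (elim k)
    have "\<epsilon> k * (- C * \<epsilon> k) \<le> \<epsilon> k * (Q k + sqrt 2 * (G (z k) \<bullet> h k) / \<epsilon> k)"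
      using elim \<epsilon>(2)[of k] by (intro mult_left_mono) auto
    moreover have "\<epsilon> k * (Q k + sqrt 2 * (G (z k) \<bullet> h k) / \<epsilon> k) = \<epsilon> k * Q k + sqrt 2 * (G (z k) \<bullet> h k)"
      using \<epsilon>(2)[of k] by (simp add: distrib_left)
    moreover have "\<epsilon> k * (- C * \<epsilon> k) = - C * (\<epsilon> k)\<^sup>2" by (simp add: power2_eq_square)
    ultimately show ?case by metis
  qed
  moreover have "(\<lambda>k. - C * (\<epsilon> k)\<^sup>2) \<longlonglongrightarrow> - C * 0\<^sup>2" by (intro tendsto_intros \<epsilon>)
  moreover have "isCont G z0" using exp by (simp add: parabolic_expansion_def)
  then have "(\<lambda>k. \<epsilon> k * Q k + sqrt 2 * (G (z k) \<bullet> h k)) \<longlonglongrightarrow> 0 * (l \<bullet> (X *v l) - c) + sqrt 2 * (G z0 \<bullet> l)"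
    by (intro tendsto_intros \<epsilon> Q h isCont_tendsto_compose[OF _ z])
  ultimately have "- C * 0\<^sup>2 \<le> 0 * (l \<bullet> (X *v l) - c) + sqrt 2 * (G z0 \<bullet> l)"
    by (intro tendsto_le[OF sequentially_bot]) auto
  then have "0 \<le> G z0 \<bullet> l" by (simp add: zero_le_mult_iff)
  then show thesis using that Q bound by blast
qed

context game
begin

lemma game_value_abs_bound:
  assumes "\<epsilon> > 0"
  shows "\<bar>game_value \<Psi> u0 \<epsilon> x t\<bar> \<le> \<bar>m\<bar> + \<bar>M\<bar>"
  using game_value_le_bound[OF assms, of x t] game_value_ge_bound[OF assms, of x t] by linarith

text \<open>
The tuple \<open>V\<close> is a limit of nearly optimal tuples.  For fixed signs \<open>b\<close>, adding the second-order
bounds for \<open>b\<close> and \<open>-b\<close> cancels the first-order terms exactly, and the first-order bounds for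
\<open>b\<close> and \<open>-b\<close> together give orthogonality to \<open>G z0\<close>.
\<close>

lemma subsolution_optimality:
  assumes U: "attained_upper_limit (\<lambda>\<epsilon> z. game_value \<Psi> u0 \<epsilon> (fst z) (snd z)) U"
    and cont_\<Psi>: "continuous_on UNIV \<Psi>" and t0: "snd z0 > 0" and free: "\<Psi> (fst z0) < U z0"
    and r: "r > 0" and cont: "continuous_on (cball z0 r) \<psi>"
    and strict: "\<And>z. z \<in> cball z0 r \<Longrightarrow> z \<noteq> z0 \<Longrightarrow> U z - \<psi> z < U z0 - \<psi> z0"
    and exp: "parabolic_expansion \<psi> G X c z0" and sym: "transpose X = X"
  shows "\<exists>v\<in>orthonormal_tuples. (\<forall>j\<in>{1..<CARD('n)}. G z0 \<bullet> v j = 0) \<and>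
    c \<le> (\<Sum>j\<in>{1..<CARD('n)}. v j \<bullet> (X *v v j))"
proof -
  let ?J = "{1..<CARD('n)}"
  let ?w = "\<lambda>\<epsilon> z. game_value \<Psi> u0 \<epsilon> (fst z) (snd z)"
  obtain z \<epsilon> where z: "z \<longlonglongrightarrow> z0" and \<epsilon>: "\<epsilon> \<longlonglongrightarrow> 0" "\<And>k::nat. \<epsilon> k > 0"
    and wz: "(\<lambda>k. ?w (\<epsilon> k) (z k)) \<longlonglongrightarrow> U z0"
    and max: "\<And>k y. y \<in> cball z0 r \<Longrightarrow> ?w (\<epsilon> k) y - \<psi> y \<le> ?w (\<epsilon> k) (z k) - \<psi> (z k) + (\<epsilon> k) ^ 3"
    by (rule penalized_maximizers[OF _ U r cont strict]) (use game_value_abs_bound in auto)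
  define good where "good k \<longleftrightarrow> snd (z k) > 0 \<and> \<Psi> (fst (z k)) < ?w (\<epsilon> k) (z k)" for k
  have ev_good: "\<forall>\<^sub>F k in sequentially. good k"
  proof -
    have "\<forall>\<^sub>F k in sequentially. 0 < snd (z k)"
      using tendsto_snd[OF z] t0 by (rule order_tendstoD)
    moreover have "(\<lambda>k. \<Psi> (fst (z k))) \<longlonglongrightarrow> \<Psi> (fst z0)"
      by (rule continuous_on_tendsto_compose[OF cont_\<Psi> tendsto_fst[OF z]]) auto
    then have "(\<lambda>k. ?w (\<epsilon> k) (z k) - \<Psi> (fst (z k))) \<longlonglongrightarrow> U z0 - \<Psi> (fst z0)"
      using wz by (intro tendsto_diff)
    then have "\<forall>\<^sub>F k in sequentially. 0 < ?w (\<epsilon> k) (z k) - \<Psi> (fst (z k))"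
      using free by (intro order_tendstoD) auto
    ultimately show ?thesis unfolding good_def by eventually_elim simp
  qed
  have "\<exists>v. v \<in> orthonormal_tuples \<and> (good k \<longrightarrow> (\<forall>b\<in>sign_choices TYPE('n).
      ?w (\<epsilon> k) (z k) \<le> ?w (\<epsilon> k) (round_step (z k) (\<epsilon> k) (displacement v b)) + (\<epsilon> k) ^ 3))" for k
  proof (cases "good k")
    case True
    have "(\<epsilon> k) ^ 3 > 0" using \<epsilon>(2) by simp
    with True obtain v where "v \<in> orthonormal_tuples"
      "\<And>b. b \<in> sign_choices TYPE('n) \<Longrightarrow> ?w (\<epsilon> k) (z k)
        \<le> game_value \<Psi> u0 (\<epsilon> k) (fst (z k) + (sqrt 2 * \<epsilon> k) *\<^sub>R displacement v b)
            (snd (z k) - (\<epsilon> k)\<^sup>2) + (\<epsilon> k) ^ 3"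
      using game_value_near_optimal[OF \<epsilon>(2)] unfolding good_def by blast
    then show ?thesis by auto
  qed (use orthonormal_tuples_nonempty in auto)
  then obtain v where v: "\<And>k. v k \<in> orthonormal_tuples"
    and opt: "\<And>k b. good k \<Longrightarrow> b \<in> sign_choices TYPE('n) \<Longrightarrow>
      ?w (\<epsilon> k) (z k) \<le> ?w (\<epsilon> k) (round_step (z k) (\<epsilon> k) (displacement (v k) b)) + (\<epsilon> k) ^ 3"
    by metis
  have "v k j \<in> sphere 0 1" if "j \<in> ?J" for k j using v[of k] that by (auto simp: orthonormal_tuples_def)
  then have "\<exists>s l. strict_mono s \<and> (\<forall>j\<in>?J. (\<lambda>k. v (s k) j) \<longlonglongrightarrow> l j)"
    by (rule convergent_subsequence_finite_family[OF finite_atLeastLessThan compact_sphere])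
  then obtain s l where s: "strict_mono s" and l: "\<And>j. j \<in> ?J \<Longrightarrow> (\<lambda>k. v (s k) j) \<longlonglongrightarrow> l j" by blast
  define V where "V = restrict l ?J"
  have V: "V \<in> orthonormal_tuples" unfolding V_def using v l by (rule orthonormal_tuples_limit)
  have zs: "(\<lambda>k. z (s k)) \<longlonglongrightarrow> z0" and \<epsilon>s: "(\<lambda>k. \<epsilon> (s k)) \<longlonglongrightarrow> 0"
    using LIMSEQ_subseq_LIMSEQ[OF z s] LIMSEQ_subseq_LIMSEQ[OF \<epsilon>(1) s] by (auto simp: o_def)
  have step: "\<exists>Q. Q \<longlonglongrightarrow> displacement V b \<bullet> (X *v displacement V b) - c \<and>
      (\<forall>\<^sub>F k in sequentially. - 2 * \<epsilon> (s k) \<le> Q k + sqrt 2 * (G (z (s k)) \<bullet> displacement (v (s k)) b) / \<epsilon> (s k)) \<and>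
      0 \<le> G z0 \<bullet> displacement V b" if b: "b \<in> sign_choices TYPE('n)" for b
  proof -
    have h: "(\<lambda>k. displacement (v (s k)) b) \<longlonglongrightarrow> displacement V b"
      unfolding V_def by (rule displacement_tendsto[of "\<lambda>k. v (s k)" l "\<lambda>_. b" b]) (use l in simp_all)
    have "\<forall>\<^sub>F k in sequentially. round_step (z (s k)) (\<epsilon> (s k)) (displacement (v (s k)) b) \<in> ball z0 r"
      using round_step_tendsto[OF zs \<epsilon>s h] r by (intro topological_tendstoD) auto
    moreover have "\<forall>\<^sub>F k in sequentially. good (s k)" using ev_good s by (rule eventually_subseq[rotated])
    ultimately have "\<forall>\<^sub>F k in sequentially. \<psi> (z (s k))
        \<le> \<psi> (round_step (z (s k)) (\<epsilon> (s k)) (displacement (v (s k)) b)) + 2 * (\<epsilon> (s k)) ^ 3"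
    proof eventually_elim
      case (elim k)
      then show ?case
        using max[of "round_step (z (s k)) (\<epsilon> (s k)) (displacement (v (s k)) b)" "s k"] opt[OF elim(2) b]
        by simp
    qed
    from almost_increasing_expansion[OF exp zs \<epsilon>s \<epsilon>(2) h this] show ?thesis by blast
  qed
  have orth_disp: "G z0 \<bullet> displacement V b = 0" and form: "c \<le> displacement V b \<bullet> (X *v displacement V b)"
    if b: "b \<in> sign_choices TYPE('n)" for b
  proof -
    let ?b' = "restrict (\<lambda>j. - b j) ?J"
    have b': "?b' \<in> sign_choices TYPE('n)" using b by (rule sign_choices_uminus)
    obtain Q Q' where Q: "Q \<longlonglongrightarrow> displacement V b \<bullet> (X *v displacement V b) - c"
        "\<forall>\<^sub>F k in sequentially. - 2 * \<epsilon> (s k) \<le> Q k + sqrt 2 * (G (z (s k)) \<bullet> displacement (v (s k)) b) / \<epsilon> (s k)"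
        "0 \<le> G z0 \<bullet> displacement V b"
      and Q': "Q' \<longlonglongrightarrow> displacement V ?b' \<bullet> (X *v displacement V ?b') - c"
        "\<forall>\<^sub>F k in sequentially. - 2 * \<epsilon> (s k) \<le> Q' k + sqrt 2 * (G (z (s k)) \<bullet> displacement (v (s k)) ?b') / \<epsilon> (s k)"
        "0 \<le> G z0 \<bullet> displacement V ?b'"
      using step[OF b] step[OF b'] by blast
    show "G z0 \<bullet> displacement V b = 0" using Q(3) Q'(3) unfolding displacement_uminus by simp
    have "X *v (- displacement V b) = - (X *v displacement V b)"
      using matrix_vector_mult_scaleR[of X "-1" "displacement V b"] by simp
    then have "(\<lambda>k. Q k + Q' k) \<longlonglongrightarrow> 2 * (displacement V b \<bullet> (X *v displacement V b) - c)"
      using tendsto_add[OF Q(1) Q'(1)] unfolding displacement_uminus by simp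
    moreover have "(\<lambda>k. - 4 * \<epsilon> (s k)) \<longlonglongrightarrow> - 4 * 0" by (intro tendsto_intros \<epsilon>s)
    moreover have "\<forall>\<^sub>F k in sequentially. - 4 * \<epsilon> (s k) \<le> Q k + Q' k"
      using Q(2) Q'(2) unfolding displacement_uminus by eventually_elim simp
    ultimately have "- 4 * 0 \<le> 2 * (displacement V b \<bullet> (X *v displacement V b) - c)"
      by (intro tendsto_le[OF sequentially_bot])
    then show "c \<le> displacement V b \<bullet> (X *v displacement V b)" by simp
  qed
  \<comment> \<open>Flipping a single sign isolates a single vector of the tuple.\<close>
  have orth: "G z0 \<bullet> V j = 0" if j: "j \<in> ?J" for j
  proof -
    define b :: "nat \<Rightarrow> real" where "b = restrict (\<lambda>_. 1) ?J"
    have b: "b \<in> sign_choices TYPE('n)" "b(j := -1) \<in> sign_choices TYPE('n)"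
      using j by (auto simp: b_def PiE_iff extensional_def)
    have "displacement V b - displacement V (b(j := -1)) = (\<Sum>i\<in>?J. if i = j then 2 *\<^sub>R V j else 0)"
      unfolding displacement_def sum_subtractf[symmetric]
      by (intro sum.cong) (auto simp: b_def scaleR_2)
    also have "\<dots> = 2 *\<^sub>R V j" using j by simp
    finally have "G z0 \<bullet> (2 *\<^sub>R V j) = G z0 \<bullet> displacement V b - G z0 \<bullet> displacement V (b(j := -1))"
      by (metis inner_diff_right)
    then show ?thesis using orth_disp b by simp
  qed
  obtain b where b: "b \<in> sign_choices TYPE('n)"
    "displacement V b \<bullet> (X *v displacement V b) \<le> (\<Sum>j\<in>?J. V j \<bullet> (X *v V j))"
    using signs_reduce_quadratic_form[OF _ matrix_form_bilinear matrix_form_symmetric[OF sym], of ?J V]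
    unfolding displacement_def by auto
  then have "c \<le> (\<Sum>j\<in>?J. V j \<bullet> (X *v V j))" using form[OF b(1)] by linarith
  then show ?thesis using V orth by blast
qed

text \<open>
The negated value function is treated, so that lower limits become upper limits and the conclusion has the
same form as for subsolutions.  The tuple is adapted to the gradient at the moving point
\<open>z k\<close>, which annihilates the first-order term before the limit is taken.  The signs vary with \<open>k\<close>, and
diagonality makes the quadratic term independent of them.
\<close>

lemma supersolution_optimality:
  assumes U: "attained_upper_limit (\<lambda>\<epsilon> z. - game_value \<Psi> u0 \<epsilon> (fst z) (snd z)) U"
    and t0: "snd z0 > 0"
    and r: "r > 0" and cont: "continuous_on (cball z0 r) \<psi>"
    and strict: "\<And>z. z \<in> cball z0 r \<Longrightarrow> z \<noteq> z0 \<Longrightarrow> U z - \<psi> z < U z0 - \<psi> z0"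
    and exp: "parabolic_expansion \<psi> G X c z0" and sym: "transpose X = X"
  shows "\<exists>v\<in>orthonormal_tuples. (\<forall>j\<in>{1..<CARD('n)}. G z0 \<bullet> v j = 0) \<and>
    c \<le> (\<Sum>j\<in>{1..<CARD('n)}. v j \<bullet> (X *v v j))"
proof -
  let ?J = "{1..<CARD('n)}"
  let ?w = "\<lambda>\<epsilon> z. - game_value \<Psi> u0 \<epsilon> (fst z) (snd z)"
  obtain z \<epsilon> where z: "z \<longlonglongrightarrow> z0" and \<epsilon>: "\<epsilon> \<longlonglongrightarrow> 0" "\<And>k::nat. \<epsilon> k > 0"
    and max: "\<And>k y. y \<in> cball z0 r \<Longrightarrow> ?w (\<epsilon> k) y - \<psi> y \<le> ?w (\<epsilon> k) (z k) - \<psi> (z k) + (\<epsilon> k) ^ 3"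
    by (rule penalized_maximizers[OF _ U r cont strict]) (use game_value_abs_bound in auto)
  have ev_good: "\<forall>\<^sub>F k in sequentially. 0 < snd (z k)"
    using tendsto_snd[OF z] t0 by (rule order_tendstoD)
  have "\<exists>v. v \<in> orthonormal_tuples \<and> (\<forall>j\<in>?J. v j \<bullet> G (z k) = 0) \<and>
      (\<forall>i\<in>?J. \<forall>j\<in>?J. i \<noteq> j \<longrightarrow> v i \<bullet> (X *v v j) = 0)" for k
    using orthonormal_tuple_diagonalizing[OF matrix_form_bilinear matrix_form_symmetric[OF sym], of "G (z k)"]
    by blast
  then obtain v where v: "\<And>k. v k \<in> orthonormal_tuples" "\<And>k j. j \<in> ?J \<Longrightarrow> v k j \<bullet> G (z k) = 0"
    and diag: "\<And>k i j. i \<in> ?J \<Longrightarrow> j \<in> ?J \<Longrightarrow> i \<noteq> j \<Longrightarrow> v k i \<bullet> (X *v v k j) = 0"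
    by metis
  have "\<exists>b. b \<in> sign_choices TYPE('n) \<and> (0 < snd (z k) \<longrightarrow>
      ?w (\<epsilon> k) (z k) \<le> ?w (\<epsilon> k) (round_step (z k) (\<epsilon> k) (displacement (v k) b)))" for k
  proof (cases "0 < snd (z k)")
    case True
    obtain b where "b \<in> sign_choices TYPE('n)"
      "game_value \<Psi> u0 (\<epsilon> k) (fst (z k) + (sqrt 2 * \<epsilon> k) *\<^sub>R displacement (v k) b) (snd (z k) - (\<epsilon> k)\<^sup>2)
        \<le> game_value \<Psi> u0 (\<epsilon> k) (fst (z k)) (snd (z k))"
      by (rule game_value_ge_outcome[OF \<epsilon>(2) True v(1)])
    then show ?thesis by auto
  qed (use sign_choices_finite_nonempty(2)[where 'n='n] in auto)
  then obtain b where b: "\<And>k. b k \<in> sign_choices TYPE('n)"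
    and opt: "\<And>k. 0 < snd (z k) \<Longrightarrow> ?w (\<epsilon> k) (z k) \<le> ?w (\<epsilon> k) (round_step (z k) (\<epsilon> k) (displacement (v k) (b k)))"
    by metis
  have vb: "(v k j, b k j) \<in> sphere 0 1 \<times> {-1, 1}" if "j \<in> ?J" for k j
    using v(1)[of k] b[of k] that by (auto simp: orthonormal_tuples_def)
  have "compact (sphere (0::real^'n) 1 \<times> {-1, 1::real})" by (intro compact_Times) auto
  from convergent_subsequence_finite_family[OF finite_atLeastLessThan this, of 1 "CARD('n)" "\<lambda>k j. (v k j, b k j)"] vb
  obtain s l where s: "strict_mono s"
    and l: "\<And>j. j \<in> ?J \<Longrightarrow> (\<lambda>k. (v (s k) j, b (s k) j)) \<longlonglongrightarrow> l j" by blast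
  have lv: "(\<lambda>k. v (s k) j) \<longlonglongrightarrow> fst (l j)" and lb: "(\<lambda>k. b (s k) j) \<longlonglongrightarrow> snd (l j)" if "j \<in> ?J" for j
    using tendsto_fst[OF l[OF that]] tendsto_snd[OF l[OF that]] by auto
  define V where "V = restrict (\<lambda>j. fst (l j)) ?J"
  define L where "L = displacement V (\<lambda>j. snd (l j))"
  have V: "V \<in> orthonormal_tuples" unfolding V_def using v(1) lv by (rule orthonormal_tuples_limit)
  have zs: "(\<lambda>k. z (s k)) \<longlonglongrightarrow> z0" and \<epsilon>s: "(\<lambda>k. \<epsilon> (s k)) \<longlonglongrightarrow> 0"
    using LIMSEQ_subseq_LIMSEQ[OF z s] LIMSEQ_subseq_LIMSEQ[OF \<epsilon>(1) s] by (auto simp: o_def)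
  have h: "(\<lambda>k. displacement (v (s k)) (b (s k))) \<longlonglongrightarrow> L"
    unfolding V_def L_def using lv lb by (rule displacement_tendsto)
  have "\<forall>\<^sub>F k in sequentially. round_step (z (s k)) (\<epsilon> (s k)) (displacement (v (s k)) (b (s k))) \<in> ball z0 r"
    using round_step_tendsto[OF zs \<epsilon>s h] r by (intro topological_tendstoD) auto
  moreover have "\<forall>\<^sub>F k in sequentially. 0 < snd (z (s k))" using ev_good s by (rule eventually_subseq[rotated])
  ultimately have incr: "\<forall>\<^sub>F k in sequentially. \<psi> (z (s k))
      \<le> \<psi> (round_step (z (s k)) (\<epsilon> (s k)) (displacement (v (s k)) (b (s k)))) + 1 * (\<epsilon> (s k)) ^ 3"
  proof eventually_elim
    case (elim k)
    then show ?case
      using max[of "round_step (z (s k)) (\<epsilon> (s k)) (displacement (v (s k)) (b (s k)))" "s k"] opt[OF elim(2)]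
      by simp
  qed
  obtain Q where Q: "Q \<longlonglongrightarrow> L \<bullet> (X *v L) - c"
    "\<forall>\<^sub>F k in sequentially. - 1 * \<epsilon> (s k)
      \<le> Q k + sqrt 2 * (G (z (s k)) \<bullet> displacement (v (s k)) (b (s k))) / \<epsilon> (s k)"
    by (rule almost_increasing_expansion[OF exp zs \<epsilon>s \<epsilon>(2) h incr]) 
  have "G (z k) \<bullet> displacement (v k) (b k) = 0" for k
    using v(2) unfolding displacement_def by (simp add: inner_sum_right inner_commute)
  then have "\<forall>\<^sub>F k in sequentially. - 1 * \<epsilon> (s k) \<le> Q k" using Q(2) by simp
  moreover have "(\<lambda>k. - 1 * \<epsilon> (s k)) \<longlonglongrightarrow> - 1 * 0" by (intro tendsto_intros \<epsilon>s)
  ultimately have "- 1 * 0 \<le> L \<bullet> (X *v L) - c" using Q(1) by (intro tendsto_le[OF sequentially_bot])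
  then have c: "c \<le> L \<bullet> (X *v L)" by simp
  have "(\<lambda>k. displacement (v (s k)) (b (s k)) \<bullet> (X *v displacement (v (s k)) (b (s k)))) \<longlonglongrightarrow> L \<bullet> (X *v L)"
    by (intro tendsto_inner h linear_continuous_on_compose matrix_vector_mul_bounded_linear[THEN bounded_linear.tendsto])
  moreover have "displacement (v k) (b k) \<bullet> (X *v displacement (v k) (b k)) = (\<Sum>j\<in>?J. v k j \<bullet> (X *v v k j))" for k
    unfolding displacement_def
    using quadratic_form_of_diagonal_signs[OF _ matrix_form_bilinear[of X], of ?J "v k" "b k"] diag b[of k]
    by (auto simp: PiE_iff)
  moreover have "(\<lambda>k. \<Sum>j\<in>?J. v (s k) j \<bullet> (X *v v (s k) j)) \<longlonglongrightarrow> (\<Sum>j\<in>?J. fst (l j) \<bullet> (X *v fst (l j)))"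
    by (intro tendsto_sum tendsto_inner lv matrix_vector_mul_bounded_linear[THEN bounded_linear.tendsto])
  ultimately have "L \<bullet> (X *v L) = (\<Sum>j\<in>?J. V j \<bullet> (X *v V j))"
    by (simp add: V_def LIMSEQ_unique)
  moreover have "G z0 \<bullet> V j = 0" if j: "j \<in> ?J" for j
  proof -
    have "isCont G z0" using exp by (simp add: parabolic_expansion_def)
    then have "(\<lambda>k. v (s k) j \<bullet> G (z (s k))) \<longlonglongrightarrow> fst (l j) \<bullet> G z0"
      using lv[OF j] zs by (intro tendsto_inner isCont_tendsto_compose[of _ G])
    then show ?thesis using v(2)[OF j] j by (simp add: V_def LIMSEQ_const_iff inner_commute)
  qed
  ultimately show ?thesis using V c by (intro bexI[of _ V]) auto
qed

end

section \<open>The half-relaxed limits of the value functions\<close>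

text \<open>
Continuity controls the difference near \<open>x\<close>; farther away the quadratic term exceeds twice the bound.
\<close>

lemma quadratic_bounds_of_bounded_continuous:
  fixes f :: "real^'n \<Rightarrow> real"
  assumes "isCont f x" "\<And>y. \<bar>f y\<bar> \<le> B" "\<delta> > 0"
  obtains C where "C \<ge> 0" "\<And>y. \<bar>f y - f x\<bar> \<le> \<delta> + C * (norm (y - x))\<^sup>2"
proof -
  obtain d where d: "d > 0" "\<And>y. dist y x < d \<Longrightarrow> dist (f y) (f x) < \<delta>"
    using assms(1,3) unfolding continuous_at_eps_delta by blast
  have B: "B \<ge> 0" using assms(2)[of x] by linarith
  have "\<bar>f y - f x\<bar> \<le> \<delta> + 2 * B / d\<^sup>2 * (norm (y - x))\<^sup>2" for y
  proof (cases "norm (y - x) < d")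
    case True
    then have "\<bar>f y - f x\<bar> \<le> \<delta>" using d(2)[of y] by (simp add: dist_norm dist_real_def)
    moreover have "0 \<le> 2 * B / d\<^sup>2 * (norm (y - x))\<^sup>2" using B by simp
    ultimately show ?thesis by linarith
  next
    case False
    have "\<bar>f y - f x\<bar> \<le> 2 * B" using assms(2)[of x] assms(2)[of y] by linarith
    also have "\<dots> = 2 * B / d\<^sup>2 * d\<^sup>2" using d by simp
    also have "\<dots> \<le> 2 * B / d\<^sup>2 * (norm (y - x))\<^sup>2"
      using False d B by (intro mult_left_mono power_mono) auto
    finally show ?thesis using assms(3) by linarith
  qed
  then show thesis using that[of "2 * B / d\<^sup>2"] B by simp
qed

locale obstacle_game = game \<Psi> u0 m M for \<Psi> u0 :: "real^'n \<Rightarrow> real" and m M :: real +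
  assumes continuous_obstacle: "continuous_on UNIV \<Psi>" and continuous_payoff: "continuous_on UNIV u0"
begin

abbreviation limit_filter :: "(real^'n) \<times> real \<Rightarrow> (((real^'n) \<times> real) \<times> real) filter" where
  "limit_filter z \<equiv> nhds z \<times>\<^sub>F at_right 0"

abbreviation upper_limit :: "(real^'n) \<times> real \<Rightarrow> ereal" where
  "upper_limit \<equiv> upper_relaxed_limit (game_value \<Psi> u0)"

abbreviation lower_limit :: "(real^'n) \<times> real \<Rightarrow> ereal" where
  "lower_limit \<equiv> lower_relaxed_limit (game_value \<Psi> u0)"

lemma upper_limit_eq:
  "upper_limit z = Limsup (limit_filter z) (\<lambda>(y, \<epsilon>). ereal (game_value \<Psi> u0 \<epsilon> (fst y) (snd y)))"
  unfolding upper_relaxed_limit_def by (simp add: split_def)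

lemma lower_limit_eq:
  "lower_limit z = - Limsup (limit_filter z) (\<lambda>(y, \<epsilon>). ereal (- game_value \<Psi> u0 \<epsilon> (fst y) (snd y)))"
proof -
  have "lower_limit z = Liminf (limit_filter z) (\<lambda>p. - (case p of (y, \<epsilon>) \<Rightarrow> ereal (- game_value \<Psi> u0 \<epsilon> (fst y) (snd y))))"
    unfolding lower_relaxed_limit_def by (simp add: split_def)
  then show ?thesis
    using ereal_Limsup_uminus[of "limit_filter z"
        "\<lambda>p. - (case p of (y, \<epsilon>) \<Rightarrow> ereal (- game_value \<Psi> u0 \<epsilon> (fst y) (snd y)))"] by simp
qed

lemma limit_filter_nontrivial: "limit_filter z \<noteq> bot"
  by (simp add: prod_filter_eq_bot trivial_limit_at_right_real)

lemma eventually_positive: "\<forall>\<^sub>F p in limit_filter z. 0 < snd p"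
  using eventually_prod2[of "nhds z" "\<lambda>\<epsilon>. 0 < \<epsilon>" "at_right (0::real)"] eventually_at_right_less[of "0::real"]
  by (simp add: split_def)

lemma limit_bounds:
  "ereal m \<le> lower_limit z" "lower_limit z \<le> upper_limit z" "upper_limit z \<le> ereal M"
proof -
  have "\<forall>\<^sub>F p in limit_filter z. (\<lambda>((y, s), \<epsilon>). ereal (game_value \<Psi> u0 \<epsilon> y s)) p \<le> ereal M"
    using eventually_positive by eventually_elim (auto simp: split_def game_value_le_bound)
  then show "upper_limit z \<le> ereal M" unfolding upper_relaxed_limit_def by (rule Limsup_bounded)
  have "\<forall>\<^sub>F p in limit_filter z. ereal m \<le> (\<lambda>((y, s), \<epsilon>). ereal (game_value \<Psi> u0 \<epsilon> y s)) p"
    using eventually_positive by eventually_elim (auto simp: split_def game_value_ge_bound)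
  then show "ereal m \<le> lower_limit z" unfolding lower_relaxed_limit_def by (rule Liminf_bounded)
  show "lower_limit z \<le> upper_limit z"
    unfolding lower_relaxed_limit_def upper_relaxed_limit_def
    by (rule Liminf_le_Limsup[OF limit_filter_nontrivial])
qed

lemma obstacle_le_lower_limit: "ereal (\<Psi> (fst z)) \<le> lower_limit z"
proof -
  have "((\<lambda>p. \<Psi> (fst (fst p))) \<longlongrightarrow> \<Psi> (fst z)) (limit_filter z)"
    using continuous_obstacle
    by (intro continuous_on_tendsto_compose[OF continuous_obstacle] tendsto_fst filterlim_fst) auto
  then have "Liminf (limit_filter z) (\<lambda>p. ereal (\<Psi> (fst (fst p)))) = ereal (\<Psi> (fst z))"
    by (intro lim_imp_Liminf limit_filter_nontrivial) simp
  moreover have "Liminf (limit_filter z) (\<lambda>p. ereal (\<Psi> (fst (fst p)))) \<le> lower_limit z"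
    unfolding lower_relaxed_limit_def
    by (intro Liminf_mono always_eventually) (auto simp: split_def obstacle_le_game_value)
  ultimately show ?thesis by simp
qed

text \<open>
The barriers around \<open>x\<close> tend to \<open>u0 x\<close> up to an arbitrarily small error as the point tends to
\<open>(x, 0)\<close> and \<open>\<epsilon>\<close> to 0.
\<close>

lemma initial_values:
  "upper_limit (x, 0) = ereal (u0 x)" "lower_limit (x, 0) = ereal (u0 x)"
proof -
  have cont: "isCont u0 x" using continuous_payoff by (simp add: continuous_on_eq_continuous_at)
  have bound: "\<bar>u0 y\<bar> \<le> \<bar>m\<bar> + \<bar>M\<bar>" for y using payoff_bounds(1)[of y] payoff_bounds(2)[of y] by linarith
  have barrier: "upper_limit (x, 0) \<le> ereal (u0 x) + ereal e \<and> ereal (u0 x) - ereal e \<le> lower_limit (x, 0)"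
    if e: "e > 0" for e
  proof -
    obtain C where C: "C \<ge> 0" "\<And>y. \<bar>u0 y - u0 x\<bar> \<le> e / 2 + C * (norm (y - x))\<^sup>2"
      using quadratic_bounds_of_bounded_continuous[OF cont bound half_gt_zero[OF e]] by blast
    define E where "E p = C * (norm (fst (fst p) - x))\<^sup>2 + 2 * C * displacement_sqnorm * max (snd (fst p) + (snd p)\<^sup>2) 0"
      for p :: "((real^'n) \<times> real) \<times> real"
    have "((\<lambda>p. fst p) \<longlongrightarrow> (x, 0)) (limit_filter (x, 0))" by (rule filterlim_fst)
    from tendsto_fst[OF this] tendsto_snd[OF this]
    have fst_lim: "((\<lambda>p. fst (fst p)) \<longlongrightarrow> x) (limit_filter (x, 0))"
      "((\<lambda>p. snd (fst p)) \<longlongrightarrow> 0) (limit_filter (x, 0))" by simp_all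
    have "filterlim snd (at_right 0) (limit_filter (x, 0))" by (rule filterlim_snd)
    then have snd_lim: "((\<lambda>p. snd p) \<longlongrightarrow> 0) (limit_filter (x, 0))"
      by (simp add: filterlim_at)
    have "(E \<longlongrightarrow> C * (norm (x - x))\<^sup>2 + 2 * C * displacement_sqnorm * max (0 + 0\<^sup>2) 0) (limit_filter (x, 0))"
      unfolding E_def[abs_def] by (intro tendsto_intros tendsto_max fst_lim snd_lim)
    then have "(E \<longlongrightarrow> 0) (limit_filter (x, 0))" by simp
    then have small: "\<forall>\<^sub>F p in limit_filter (x, 0). E p < e / 2"
      using e by (intro order_tendstoD) auto
    have "\<forall>\<^sub>F p in limit_filter (x, 0).
        (\<lambda>((y, s), \<epsilon>). ereal (game_value \<Psi> u0 \<epsilon> y s)) p \<le> ereal (u0 x + e) \<and>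
        ereal (u0 x - e) \<le> (\<lambda>((y, s), \<epsilon>). ereal (game_value \<Psi> u0 \<epsilon> y s)) p"
      using small eventually_positive
    proof eventually_elim
      case (elim p)
      have "u0 y \<le> (u0 x + e / 2) + C * (norm (y - x))\<^sup>2" "(u0 x - e / 2) - C * (norm (y - x))\<^sup>2 \<le> u0 y" for y
        using C(2)[of y] by linarith+
      from game_value_upper_barrier[OF elim(2) C(1) this(1), of "fst (fst p)" "snd (fst p)"]
        game_value_lower_barrier[OF elim(2) C(1) this(2), of "fst (fst p)" "snd (fst p)"]
      show ?case using elim(1) by (simp add: split_def E_def)
    qed
    then have ev: "\<forall>\<^sub>F p in limit_filter (x, 0).
        (\<lambda>((y, s), \<epsilon>). ereal (game_value \<Psi> u0 \<epsilon> y s)) p \<le> ereal (u0 x + e)"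
      "\<forall>\<^sub>F p in limit_filter (x, 0).
        ereal (u0 x - e) \<le> (\<lambda>((y, s), \<epsilon>). ereal (game_value \<Psi> u0 \<epsilon> y s)) p"
      by (simp_all only: eventually_conj_iff)
    show ?thesis
      using Limsup_bounded[OF ev(1)] Liminf_bounded[OF ev(2)]
      unfolding upper_relaxed_limit_def lower_relaxed_limit_def by simp
  qed
  have "upper_limit (x, 0) \<le> ereal (u0 x)"
    by (rule ereal_le_epsilon2) (use barrier in blast)
  moreover have "ereal (u0 x) \<le> lower_limit (x, 0)"
  proof (rule ereal_le_epsilon2)
    fix e :: real assume "0 < e"
    then have "ereal (u0 x) - ereal e \<le> lower_limit (x, 0)" using barrier by blast
    then show "ereal (u0 x) \<le> lower_limit (x, 0) + ereal e"
      using add_right_mono[of _ _ "ereal e"] by fastforce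
  qed
  ultimately show "upper_limit (x, 0) = ereal (u0 x)" "lower_limit (x, 0) = ereal (u0 x)"
    using limit_bounds(2)[of "(x, 0)"] by (meson antisym order_trans)+
qed

lemma upper_envelope: "z \<in> space_time \<Longrightarrow> usc_envelope space_time upper_limit z = upper_limit z"
  unfolding upper_limit_eq[abs_def] by (rule usc_envelope_Limsup)

lemma lower_envelope: "z \<in> space_time \<Longrightarrow> lsc_envelope space_time lower_limit z = lower_limit z"
  unfolding lower_limit_eq[abs_def] lsc_envelope_uminus by (simp add: usc_envelope_Limsup)

section \<open>The viscosity inequalities\<close>

definition real_upper_limit :: "(real^'n) \<times> real \<Rightarrow> real" where
  "real_upper_limit z = real_of_ereal (upper_limit z)"

definition real_lower_limit :: "(real^'n) \<times> real \<Rightarrow> real" where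
  "real_lower_limit z = real_of_ereal (lower_limit z)"

lemma real_limits:
  "upper_limit z = ereal (real_upper_limit z)" "lower_limit z = ereal (real_lower_limit z)"
  using limit_bounds[of z] unfolding real_upper_limit_def real_lower_limit_def
  by (cases "upper_limit z"; cases "lower_limit z"; simp)+

lemma attained_upper: "attained_upper_limit (\<lambda>\<epsilon> z. game_value \<Psi> u0 \<epsilon> (fst z) (snd z)) real_upper_limit"
  by (rule attained_upper_limitI[where B="\<bar>m\<bar> + \<bar>M\<bar>"])
    (simp_all add: game_value_abs_bound upper_limit_eq[symmetric] real_limits)

lemma attained_lower:
  "attained_upper_limit (\<lambda>\<epsilon> z. - game_value \<Psi> u0 \<epsilon> (fst z) (snd z)) (\<lambda>z. - real_lower_limit z)"
proof (rule attained_upper_limitI[where B="\<bar>m\<bar> + \<bar>M\<bar>"])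
  fix z
  let ?L = "Limsup (limit_filter z) (\<lambda>(y, \<epsilon>). ereal (- game_value \<Psi> u0 \<epsilon> (fst y) (snd y)))"
  have "- ?L = ereal (real_lower_limit z)" using lower_limit_eq[of z] real_limits(2)[of z] by (rule trans[OF sym])
  then have "- (- ?L) = - ereal (real_lower_limit z)" by (rule arg_cong)
  then show "?L = ereal (- real_lower_limit z)" unfolding ereal_uminus_uminus uminus_ereal.simps .
qed (simp add: game_value_abs_bound)

text \<open>
The factor \<open>\<sigma>\<close> is \<open>1\<close> for subsolutions and \<open>-1\<close> for supersolutions.
\<close>

lemma strict_maximum_of_local:
  fixes V \<phi> :: "(real^'n) \<times> real \<Rightarrow> real"
  assumes smooth: "smooth_on (UNIV \<times> {0<..}) \<phi>" and t0: "snd z0 > 0"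
    and max: "\<forall>\<^sub>F z in nhds z0. V z - \<sigma> * \<phi> z \<le> V z0 - \<sigma> * \<phi> z0"
  obtains r where "r > 0" "continuous_on (cball z0 r) (\<lambda>z. \<sigma> * \<phi> z + ((norm (z - z0))\<^sup>2)\<^sup>2)"
    "\<And>z. z \<in> cball z0 r \<Longrightarrow> z \<noteq> z0 \<Longrightarrow>
      V z - (\<sigma> * \<phi> z + ((norm (z - z0))\<^sup>2)\<^sup>2) < V z0 - (\<sigma> * \<phi> z0 + ((norm (z0 - z0))\<^sup>2)\<^sup>2)"
proof -
  let ?S = "UNIV \<times> {0<..} :: ((real^'n) \<times> real) set"
  have S: "open ?S" "z0 \<in> ?S" using t0 by (auto intro: open_Times simp: mem_Times_iff)
  obtain r1 where r1: "r1 > 0" "cball z0 r1 \<subseteq> ?S" using S open_contains_cball by blast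
  obtain r2 where r2: "r2 > 0" "\<And>z. dist z z0 < r2 \<Longrightarrow> V z - \<sigma> * \<phi> z \<le> V z0 - \<sigma> * \<phi> z0"
    using max unfolding eventually_nhds_metric by blast
  have "continuous_on ?S \<phi>" using smooth unfolding smooth_on_def by (metis k_times_cont_diff_on.simps(1))
  then have "continuous_on (cball z0 (min r1 (r2 / 2))) \<phi>"
    by (rule continuous_on_subset) (use r1 in auto)
  then have "continuous_on (cball z0 (min r1 (r2 / 2))) (\<lambda>z. \<sigma> * \<phi> z + ((norm (z - z0))\<^sup>2)\<^sup>2)"
    by (intro continuous_intros)
  moreover have "V z - (\<sigma> * \<phi> z + ((norm (z - z0))\<^sup>2)\<^sup>2) < V z0 - (\<sigma> * \<phi> z0 + ((norm (z0 - z0))\<^sup>2)\<^sup>2)"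
    if "z \<in> cball z0 (min r1 (r2 / 2))" "z \<noteq> z0" for z
  proof -
    have "dist z z0 < r2" using that(1) r2(1) by (auto simp: dist_commute)
    moreover have "((norm (z - z0))\<^sup>2)\<^sup>2 > 0" "((norm (z0 - z0))\<^sup>2)\<^sup>2 = 0" using that(2) by auto
    ultimately show ?thesis using r2(2)[of z] by linarith
  qed
  ultimately show thesis using that[of "min r1 (r2 / 2)"] r1(1) r2(1) by simp
qed

lemma eventually_in_space_time: "t0 > 0 \<Longrightarrow> \<forall>\<^sub>F z in nhds (x0, t0). z \<in> (space_time :: ((real^'n) \<times> real) set)"
  using eventually_nhds_in_open[OF open_Times[OF open_UNIV open_greaterThan[of 0]], of "(x0, t0)"]
  by (auto elim!: eventually_mono)

lemma upper_limit_subsolution: "viscosity_subsolution \<Psi> u0 upper_limit"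
  unfolding viscosity_subsolution_def Let_def
proof (intro conjI allI impI)
  fix x :: "real^'n" and t :: real assume "t > 0"
  then show "ereal (\<Psi> x) \<le> usc_envelope space_time upper_limit (x, t)"
    using order_trans[OF obstacle_le_lower_limit limit_bounds(2), of "(x, t)"] by (simp add: upper_envelope)
next
  fix x :: "real^'n"
  show "usc_envelope space_time upper_limit (x, 0) \<le> ereal (u0 x)"
    by (simp add: upper_envelope initial_values)
next
  fix \<phi> :: "(real^'n) \<times> real \<Rightarrow> real" and x0 :: "real^'n" and t0 :: real
  let ?us = "usc_envelope space_time upper_limit"
  assume A: "smooth_on (UNIV \<times> {0<..}) \<phi> \<and> 0 < t0 \<and>
    (\<forall>\<^sub>F z in nhds (x0, t0). ?us z - ereal (\<phi> z) \<le> ?us (x0, t0) - ereal (\<phi> (x0, t0))) \<and>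
    ereal (\<Psi> x0) < ?us (x0, t0)"
  then have smooth: "smooth_on (UNIV \<times> {0<..}) \<phi>" and t0: "0 < t0" by auto
  have us0: "?us (x0, t0) = ereal (real_upper_limit (x0, t0))"
    using t0 by (simp add: upper_envelope real_limits)
  have "\<forall>\<^sub>F z in nhds (x0, t0). real_upper_limit z - 1 * \<phi> z \<le> real_upper_limit (x0, t0) - 1 * \<phi> (x0, t0)"
    using A[THEN conjunct2, THEN conjunct2, THEN conjunct1] eventually_in_space_time[OF t0]
    by eventually_elim (simp add: us0 upper_envelope real_limits)
  from strict_maximum_of_local[OF smooth _ this] t0 obtain r where r: "r > 0"
    "continuous_on (cball (x0, t0) r) (\<lambda>z. 1 * \<phi> z + ((norm (z - (x0, t0)))\<^sup>2)\<^sup>2)"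
    "\<And>z. z \<in> cball (x0, t0) r \<Longrightarrow> z \<noteq> (x0, t0) \<Longrightarrow>
      real_upper_limit z - (1 * \<phi> z + ((norm (z - (x0, t0)))\<^sup>2)\<^sup>2)
      < real_upper_limit (x0, t0) - (1 * \<phi> (x0, t0) + ((norm ((x0, t0) - (x0, t0)))\<^sup>2)\<^sup>2)"
    unfolding snd_conv by blast
  let ?c = "deriv (\<lambda>t. \<phi> (x0, t)) t0" and ?p = "gradient (\<lambda>x. \<phi> (x, t0)) x0"
    and ?X = "hessian (\<lambda>x. \<phi> (x, t0)) x0"
  obtain G where G: "G (x0, t0) = ?p" "parabolic_expansion \<phi> G ?X ?c (x0, t0)"
    using smooth_parabolic_expansion(1)[OF smooth t0] by blast
  have X: "transpose ?X = ?X" by (rule smooth_parabolic_expansion(2)[OF smooth t0])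
  have exp: "parabolic_expansion (\<lambda>z. 1 * \<phi> z + ((norm (z - (x0, t0)))\<^sup>2)\<^sup>2)
      (\<lambda>z. G z + (4 * (norm (z - (x0, t0)))\<^sup>2) *\<^sub>R (fst z - fst (x0, t0))) ?X ?c (x0, t0)"
    using parabolic_expansion_add[OF G(2) parabolic_expansion_quartic] by simp
  have "\<Psi> (fst (x0, t0)) < real_upper_limit (x0, t0)" using A us0 by simp
  from subsolution_optimality[OF attained_upper continuous_obstacle _ this r(1,2) r(3) exp X] t0
  obtain v where v: "v \<in> orthonormal_tuples" "\<And>j. j \<in> {1..<CARD('n)} \<Longrightarrow> ?p \<bullet> v j = 0"
    "?c \<le> (\<Sum>j\<in>{1..<CARD('n)}. v j \<bullet> (?X *v v j))"
    using G(1) by auto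
  have "ereal ?c + mcf_operator_lsc ?p ?X \<le> ereal ?c + ereal (- (\<Sum>j\<in>{1..<CARD('n)}. v j \<bullet> (?X *v v j)))"
    using mcf_envelope_bounds(1)[OF v(1) X v(2)] by (intro add_left_mono)
  also have "\<dots> \<le> 0" using v(3) by simp
  finally show "ereal ?c + mcf_operator_lsc ?p ?X \<le> 0" .
qed

lemma lower_limit_supersolution: "viscosity_supersolution \<Psi> u0 lower_limit"
  unfolding viscosity_supersolution_def Let_def
proof (intro conjI allI impI)
  fix x :: "real^'n" and t :: real assume "t > 0"
  then show "ereal (\<Psi> x) \<le> lsc_envelope space_time lower_limit (x, t)"
    using obstacle_le_lower_limit[of "(x, t)"] by (simp add: lower_envelope)
next
  fix x :: "real^'n"
  show "lsc_envelope space_time lower_limit (x, 0) \<ge> ereal (u0 x)"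
    by (simp add: lower_envelope initial_values)
next
  fix \<phi> :: "(real^'n) \<times> real \<Rightarrow> real" and x0 :: "real^'n" and t0 :: real
  let ?us = "lsc_envelope space_time lower_limit"
  assume A: "smooth_on (UNIV \<times> {0<..}) \<phi> \<and> 0 < t0 \<and>
    (\<forall>\<^sub>F z in nhds (x0, t0). ?us z - ereal (\<phi> z) \<ge> ?us (x0, t0) - ereal (\<phi> (x0, t0)))"
  then have smooth: "smooth_on (UNIV \<times> {0<..}) \<phi>" and t0: "0 < t0" by auto
  have us0: "?us (x0, t0) = ereal (real_lower_limit (x0, t0))"
    using t0 by (simp add: lower_envelope real_limits)
  have "\<forall>\<^sub>F z in nhds (x0, t0).
      - real_lower_limit z - (-1) * \<phi> z \<le> - real_lower_limit (x0, t0) - (-1) * \<phi> (x0, t0)"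
    using A[THEN conjunct2, THEN conjunct2] eventually_in_space_time[OF t0]
    by eventually_elim (simp add: us0 lower_envelope real_limits)
  from strict_maximum_of_local[OF smooth _ this] t0 obtain r where r: "r > 0"
    "continuous_on (cball (x0, t0) r) (\<lambda>z. (-1) * \<phi> z + ((norm (z - (x0, t0)))\<^sup>2)\<^sup>2)"
    "\<And>z. z \<in> cball (x0, t0) r \<Longrightarrow> z \<noteq> (x0, t0) \<Longrightarrow>
      - real_lower_limit z - ((-1) * \<phi> z + ((norm (z - (x0, t0)))\<^sup>2)\<^sup>2)
      < - real_lower_limit (x0, t0) - ((-1) * \<phi> (x0, t0) + ((norm ((x0, t0) - (x0, t0)))\<^sup>2)\<^sup>2)"
    unfolding snd_conv by blast
  let ?c = "deriv (\<lambda>t. \<phi> (x0, t)) t0" and ?p = "gradient (\<lambda>x. \<phi> (x, t0)) x0"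
    and ?X = "hessian (\<lambda>x. \<phi> (x, t0)) x0"
  obtain G where G: "G (x0, t0) = ?p" "parabolic_expansion \<phi> G ?X ?c (x0, t0)"
    using smooth_parabolic_expansion(1)[OF smooth t0] by blast
  have X: "transpose ?X = ?X" by (rule smooth_parabolic_expansion(2)[OF smooth t0])
  then have X': "transpose (- ?X) = - ?X" by (simp add: transpose_def vec_eq_iff)
  have exp: "parabolic_expansion (\<lambda>z. (-1) * \<phi> z + ((norm (z - (x0, t0)))\<^sup>2)\<^sup>2)
      (\<lambda>z. - G z + (4 * (norm (z - (x0, t0)))\<^sup>2) *\<^sub>R (fst z - fst (x0, t0))) (- ?X) (- ?c) (x0, t0)"
    using parabolic_expansion_add[OF parabolic_expansion_uminus[OF G(2)] parabolic_expansion_quartic] by simp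
  from supersolution_optimality[OF attained_lower _ r(1,2) r(3) exp X'] t0
  obtain v where v: "v \<in> orthonormal_tuples" "\<And>j. j \<in> {1..<CARD('n)} \<Longrightarrow> ?p \<bullet> v j = 0"
    "- ?c \<le> (\<Sum>j\<in>{1..<CARD('n)}. v j \<bullet> (- ?X *v v j))"
    using G(1) by auto
  have "- ?X *v y = - (?X *v y)" for y using matrix_vector_mult_diff_rdistrib[of 0 ?X y] by simp
  then have "0 \<le> ereal ?c + ereal (- (\<Sum>j\<in>{1..<CARD('n)}. v j \<bullet> (?X *v v j)))"
    using v(3) by (simp add: sum_negf)
  also have "\<dots> \<le> ereal ?c + mcf_operator_usc ?p ?X"
    using mcf_envelope_bounds(2)[OF v(1) X v(2)] by (intro add_left_mono)
  finally show "0 \<le> ereal ?c + mcf_operator_usc ?p ?X" .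
qed

end

theorem proposition1p1:
  fixes \<Psi> u0 :: "real^'n \<Rightarrow> real" and a R :: real
  assumes "CARD('n) \<ge> 2"
    and "\<exists>L. L-lipschitz_on UNIV \<Psi>"
    and "continuous_on UNIV u0"
    and "\<forall>x. \<Psi> x \<le> u0 x"
    and "a < 0" and "R > 0"
    and "\<forall>x. x \<notin> ball 0 R \<longrightarrow> u0 x = a"
  shows "viscosity_subsolution \<Psi> u0 (upper_relaxed_limit (game_value \<Psi> u0)) \<and>
    viscosity_supersolution \<Psi> u0 (lower_relaxed_limit (game_value \<Psi> u0)) \<and>
    (\<forall>x. upper_relaxed_limit (game_value \<Psi> u0) (x, 0) = ereal (u0 x) \<and>
         lower_relaxed_limit (game_value \<Psi> u0) (x, 0) = ereal (u0 x))"
proof -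
  have "compact (u0 ` cball 0 R)"
    using assms(3) by (intro compact_continuous_image continuous_on_subset[OF assms(3)]) auto
  then have "bounded (u0 ` cball 0 R)" by (rule compact_imp_bounded)
  then obtain B where "\<forall>y\<in>u0 ` cball 0 R. norm y \<le> B" unfolding bounded_iff by blast
  then have B: "\<bar>u0 x\<bar> \<le> B" if "x \<in> cball 0 R" for x using that by auto
  have bound: "\<bar>u0 x\<bar> \<le> max B \<bar>a\<bar>" for x
    using B[of x] assms(7) by (cases "x \<in> ball 0 R") (auto simp: le_max_iff_disj less_imp_le)
  have "continuous_on UNIV \<Psi>" using assms(2) lipschitz_on_continuous_on by blast
  then interpret obstacle_game \<Psi> u0 "- max B \<bar>a\<bar>" "max B \<bar>a\<bar>"
    using assms(3,4) bound by unfold_locales (auto simp: abs_le_iff dest: spec, (metis abs_le_iff minus_le_iff)+)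
  show ?thesis
    using upper_limit_subsolution lower_limit_supersolution initial_values by blast
qed


end
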